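(* Let $f(\cdot;i):\mathbb{R}^d\to\mathbb{R}$, $i\in[n]$, and $F(w)=\frac1n\sum_{i=1}^n f(w;i)$. Assume: (a) $\mathrm{dom}(F)\neq\emptyset$ and $F_*:=\inf_{w\in\mathbb{R}^d}F(w)>-\infty$; (b) there is $L>0$ such that for every $i\in[n]$ and all $w,w'\in\mathrm{dom}(F)$, $\|\nabla f(w;i)-\nabla f(w';i)\|\le L\|w-w'\|$; (c) there are finite constants $\Theta,\sigma\ge 0$ such that for all $w\in\mathrm{dom}(F)$, $\frac1n\sum_{i=1}^n\|\nabla f(w;i)-\nabla F(w)\|^2\le\Theta\|\nabla F(w)\|^2+\sigma^2$. Let the iterates be generated by the SMG algorithm (described in the context) under the randomized reshuffling strategy, with a fixed momentum weight $0\le\beta<1$ and learning rates $\eta_i^{(t)}=\frac{\eta_t}{n}$. Set $\eta_0:=\eta_1$ and assume $\eta_t\ge\eta_{t+1}$ and $0<\eta_t\le\frac{1}{L\sqrt D}$ for $t\ge1$, where $D:=\max\left(\frac53,\frac{6(5-3\beta)(\Theta+n)}{n(1-\beta)}\right)$. Then $$\mathbb{E}\big[\|\nabla F(\hat w_T)\|^2\big]=\frac{1}{\sum_{t=1}^T\eta_t}\sum_{t=1}^T\eta_t\,\mathbb{E}\big[\|\nabla F(\tilde w_{t-1})\|^2\big]\le\frac{4[F(\tilde w_0)-F_*]}{(1-\beta)\sum_{t=1}^T\eta_t}+\frac{6\sigma^2(5-3\beta)L^2}{n(1-\beta)}\left(\frac{\sum_{t=1}^T\eta_{t-1}^3}{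\sum_{t=1}^T\eta_t}\right).$$
   Context: $[n]=\{1,\dots,n\}$; $\|\cdot\|$ is the Euclidean norm; $\mathbb{E}$ is expectation over all randomness (permutations and output). Since each $f(\cdot;i)$ is real-valued on $\mathbb{R}^d$, $\mathrm{dom}(F)=\mathbb{R}^d$; each $f(\cdot;i)$ is differentiable. SMG algorithm (Shuffling Momentum Gradient), with parameters $\beta$, number of epochs $T\ge1$, and $\eta_t$: Choose $\tilde w_0\in\mathbb{R}^d$ (deterministic) and set $\tilde m_0:=0$. For $t=1,\dots,T$: set $w_0^{(t)}:=\tilde w_{t-1}$, $m_0^{(t)}:=\tilde m_{t-1}$, $v_0^{(t)}:=0$; generate a permutation $\pi^{(t)}$ of $[n]$; for $i=0,\dots,n-1$ put $g_i^{(t)}:=\nabla f(w_i^{(t)};\pi^{(t)}(i+1))$ and $$m_{i+1}^{(t)}:=\beta m_0^{(t)}+(1-\beta)g_i^{(t)},\quad v_{i+1}^{(t)}:=v_i^{(t)}+\tfrac1n g_i^{(t)},\quad w_{i+1}^{(t)}:=w_i^{(t)}-\tfrac{\eta_t}{n}m_{i+1}^{(t)};$$ then set $\tilde w_t:=w_n^{(t)}$ and $\tilde m_t:=v_n^{(t)}$. Output: $\hat w_T\in\{\tilde w_0,\dots,\tilde w_{T-1}\}$ chosen at random (independently of the permutations) with probability $\mathbb{P}[\hat w_T=\tilde w_{t-1}]=\eta_t/\sum_{s=1}^T\eta_s$. Randomized reshuffling strategy: at each epoch $t$, $\pi^{(t)}=(\pi^{(t)}(1),\dots,\pi^{(t)}(n))$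 is uniformly sampled at random without replacement from $\{1,\dots,n\}$ (a uniformly random permutation), independently of the previous epochs. *)

theory Defs
  imports "HOL-Probability.Probability"
begin

definition grad :: "('a::real_inner \<Rightarrow> real) \<Rightarrow> 'a \<Rightarrow> 'a" where
  "grad f x = (THE D. GDERIV f x :> D)"

lemma GDERIV_grad:
  fixes f :: "'a::euclidean_space \<Rightarrow> real"
  assumes "f differentiable (at x)"
  shows "GDERIV f x :> grad f x"
proof -
  obtain f' where f': "(f has_derivative f') (at x)"
    using assms unfolding differentiable_def by blast
  then interpret f': bounded_linear f' by (rule has_derivative_bounded_linear)
  define D where "D = (\<Sum>b\<in>Basis. f' b *\<^sub>R b)"
  have f'_eq: "f' h = h \<bullet> D" for h
  proof -
    have "f' h = f' (\<Sum>b\<in>Basis. (h \<bullet> b) *\<^sub>R b)" by (simp add: euclidean_representation)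
    also have "\<dots> = (\<Sum>b\<in>Basis. (h \<bullet> b) * f' b)" by (simp add: f'.sum f'.scale)
    also have "\<dots> = h \<bullet> D"
      by (simp add: D_def inner_sum_right mult.commute)
    finally show ?thesis .
  qed
  have "GDERIV f x :> D"
  proof -
    have "f' = (\<lambda>h. h \<bullet> D)" using f'_eq by auto
    then show ?thesis using f' by (simp add: gderiv_def)
  qed
  moreover have "E = D" if "GDERIV f x :> E" for E
  proof -
    have "(\<lambda>h. h \<bullet> E) = f'"
      using that f' unfolding gderiv_def by (rule has_derivative_unique)
    then have "(E - D) \<bullet> (E - D) = 0"
      by (metis f'_eq inner_diff_right right_minus_eq)
    then show ?thesis by simp
  qed
  ultimately show ?thesis unfolding grad_def by (rule theI)
qed

text \<open>
  \<open>smg_epoch f n \<beta> \<eta> p w\<^sub>0 m\<^sub>0 i\<close> is the triple \<open>(w\<^sub>i, m\<^sub>i, v\<^sub>i)\<close> within one epoch that uses the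
  permutation \<open>p\<close>. The momentum is computed from \<open>m\<^sub>0\<close>, the momentum at the start of the
  epoch, and not from the preceding \<open>m\<^sub>i\<close>.
\<close>

primrec smg_epoch ::
  "(nat \<Rightarrow> 'a::real_inner \<Rightarrow> real) \<Rightarrow> nat \<Rightarrow> real \<Rightarrow> real \<Rightarrow> (nat \<Rightarrow> nat) \<Rightarrow> 'a \<Rightarrow> 'a \<Rightarrow> nat
    \<Rightarrow> 'a \<times> 'a \<times> 'a" where
  "smg_epoch f n \<beta> \<eta> p w0 m0 0 = (w0, m0, 0)"
| "smg_epoch f n \<beta> \<eta> p w0 m0 (Suc i) =
    (let (w, m, v) = smg_epoch f n \<beta> \<eta> p w0 m0 i;
         g = grad (f (p (i + 1))) w;
         m' = \<beta> *\<^sub>R m0 + (1 - \<beta>) *\<^sub>R g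
     in (w - (\<eta> / real n) *\<^sub>R m', m', v + (1 / real n) *\<^sub>R g))"

text \<open>
  \<open>smg_state f n \<beta> \<eta> \<pi> w\<^sub>0 t\<close> is the pair of the iterate and the momentum after \<open>t\<close> epochs, where
  \<open>\<pi> t\<close> and \<open>\<eta> t\<close> are the permutation and the learning rate of epoch \<open>t \<ge> 1\<close>. The momentum that
  is passed on is the averaged gradient \<open>v\<^sub>n\<close>, not \<open>m\<^sub>n\<close>.
\<close>

primrec smg_state ::
  "(nat \<Rightarrow> 'a::real_inner \<Rightarrow> real) \<Rightarrow> nat \<Rightarrow> real \<Rightarrow> (nat \<Rightarrow> real) \<Rightarrow> (nat \<Rightarrow> nat \<Rightarrow> nat) \<Rightarrow> 'a \<Rightarrow> nat
    \<Rightarrow> 'a \<times> 'a" where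
  "smg_state f n \<beta> \<eta> \<pi> w0 0 = (w0, 0)"
| "smg_state f n \<beta> \<eta> \<pi> w0 (Suc t) =
    (let (w, m) = smg_state f n \<beta> \<eta> \<pi> w0 t;
         (w', m', v') = smg_epoch f n \<beta> (\<eta> (Suc t)) (\<pi> (Suc t)) w m n
     in (w', v'))"

definition smg_iterate ::
  "(nat \<Rightarrow> 'a::real_inner \<Rightarrow> real) \<Rightarrow> nat \<Rightarrow> real \<Rightarrow> (nat \<Rightarrow> real) \<Rightarrow> (nat \<Rightarrow> nat \<Rightarrow> nat) \<Rightarrow> 'a \<Rightarrow> nat
    \<Rightarrow> 'a" where
  "smg_iterate f n \<beta> \<eta> \<pi> w0 t = fst (smg_state f n \<beta> \<eta> \<pi> w0 t)"

definition perms :: "nat \<Rightarrow> (nat \<Rightarrow> nat) set" where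
  "perms n = {p. p permutes {1..n}}"

definition randomized_reshuffling ::
  "'s measure \<Rightarrow> nat \<Rightarrow> nat \<Rightarrow> (nat \<Rightarrow> 's \<Rightarrow> nat \<Rightarrow> nat) \<Rightarrow> bool" where
  "randomized_reshuffling M n T \<pi> \<longleftrightarrow>
    prob_space.indep_vars M (\<lambda>_. count_space (perms n)) \<pi> {1..T} \<and>
    (\<forall>t\<in>{1..T}. distr M (count_space (perms n)) (\<pi> t) = uniform_count_measure (perms n))"

text \<open>
  The output is the iterate \<open>w\<^bsub>K-1\<^esub>\<close>, with a random index \<open>K\<close> in \<open>{1..T}\<close> that is independent of
  the whole family of permutations and takes the value \<open>t\<close> with probability proportional to \<open>\<eta> t\<close>.
  Independence is stated for the generated \<open>\<sigma>\<close>-algebras, because \<open>indep_var\<close> would need both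
  variables to have the same type.
\<close>

definition random_output_index ::
  "'s measure \<Rightarrow> nat \<Rightarrow> nat \<Rightarrow> (nat \<Rightarrow> real) \<Rightarrow> (nat \<Rightarrow> 's \<Rightarrow> nat \<Rightarrow> nat) \<Rightarrow> ('s \<Rightarrow> nat) \<Rightarrow> bool" where
  "random_output_index M n T \<eta> \<pi> K \<longleftrightarrow>
    K \<in> measurable M (count_space {1..T}) \<and>
    prob_space.indep_set M
      {(\<lambda>\<omega>. \<lambda>t\<in>{1..T}. \<pi> t \<omega>) -` A \<inter> space M | A.
        A \<in> sets (Pi\<^sub>M {1..T} (\<lambda>_. count_space (perms n)))}
      {K -` B \<inter> space M | B. B \<in> sets (count_space {1..T})} \<and>
    (\<forall>t\<in>{1..T}. measure M {\<omega> \<in> space M. K \<omega> = t} = \<eta> t / (\<Sum>s=1..T. \<eta> s))"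

end

theory Submission
  imports Defs
begin

text \<open>
  Over one epoch the method moves along \<open>- \<eta> (\<beta> m + (1 - \<beta>) v)\<close>, where \<open>m\<close> and \<open>v\<close> are the averaged
  gradients of the previous and of the current epoch. Smoothness gives descent by
  \<open>\<eta> / 2 * \<parallel>\<nabla>F\<parallel>\<^sup>2\<close> up to the squared distances of \<open>m\<close> and \<open>v\<close> from \<open>\<nabla>F\<close> at the start of the epoch.
  Both distances are controlled by the drift of the inner iterates, measured from the start of the
  current epoch for \<open>v\<close> and to the end of the previous epoch for \<open>m\<close>. By \<open>drift_bounds\<close>, the drift
  is of size \<open>\<eta>\<^sup>2\<close> times \<open>\<parallel>\<beta> m + (1 - \<beta>) \<nabla>F\<parallel>\<^sup>2\<close> plus a shuffling deviation, which collects the prefix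
  sums of the centred component gradients in the order of the permutation.

  Since the error of \<open>m\<close> is produced one epoch before it is used, the objective alone does not
  decrease; \<open>F + 2 / 3 * \<eta> * \<parallel>\<nabla>F - m\<parallel>\<^sup>2\<close> does, up to the shuffling deviation and a multiple of
  \<open>\<eta>\<^sup>3 * \<parallel>\<nabla>F\<parallel>\<^sup>2\<close> (\<open>epoch_lyapunov_decrease\<close>). Summing over the epochs yields a bound for every choice of the permutations (\<open>smg_trajectory_bound\<close>).

  Only the shuffling deviation needs randomness. Sampling without replacement from a population
  with mean zero is negatively correlated, so the prefix sums of a uniformly random permutation
  have at most the variance of independent samples; this gives the factor \<open>1 / n\<close>
  (\<open>sum_perms_shuffling_deviation_le\<close>). The permutation of an epoch is independent of the point at
  which the epoch starts, so this average may be taken inside the expectation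
  (\<open>expectation_fresh_perm\<close>). The variance condition and the bound on the learning rates then let
  half of the decrease absorb all gradient terms, and the \<open>\<sigma>\<^sup>2\<close> terms remain.

  All random quantities are functions of finitely many permutations. Hence integrability is
  automatic, and independence is used only for events that fix the value of a finite-valued variable.
\<close>

section \<open>Sums over random permutations\<close>

lemma norm_sum_squared:
  fixes x :: "'b \<Rightarrow> 'a::real_inner"
  shows "(norm (\<Sum>j\<in>J. x j))\<^sup>2 = (\<Sum>j\<in>J. \<Sum>k\<in>J. x j \<bullet> x k)"
  unfolding power2_norm_eq_inner inner_sum_left inner_sum_right by (rule sum.swap)

text \<open>
  The symmetry behind the next lemmas: precomposing with a transposition permutes the set of all
  permutations, so that a sum over permutations does not depend on the position that is inspected.
\<close>

lemma sum_permutes_transpose: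
  assumes "a \<in> S" "b \<in> S"
  shows "(\<Sum>p | p permutes S. h p) = (\<Sum>p | p permutes S. h (p \<circ> Transposition.transpose a b))"
  using sum_permutations_compose_right[OF permutes_swap_id[OF assms], of h] .

lemma sum_permutes_norm_squared:
  fixes x :: "'b \<Rightarrow> 'a::real_inner"
  assumes S: "finite S" and j: "j \<in> S"
  shows "(\<Sum>p | p permutes S. (norm (x (p j)))\<^sup>2)
    = fact (card S) / card S * (\<Sum>i\<in>S. (norm (x i))\<^sup>2)"
proof -
  define c where "c l = (\<Sum>p | p permutes S. (norm (x (p l)))\<^sup>2)" for l
  have c: "c l = c j" if "l \<in> S" for l
    unfolding c_def
    using sum_permutes_transpose[OF that j, of "\<lambda>p. (norm (x (p l)))\<^sup>2"] by simp
  have "card S * c j = (\<Sum>l\<in>S. c l)" by (simp add: c)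
  also have "\<dots> = (\<Sum>p | p permutes S. \<Sum>l\<in>S. (norm (x (p l)))\<^sup>2)"
    unfolding c_def by (rule sum.swap)
  also have "\<dots> = (\<Sum>p | p permutes S. \<Sum>i\<in>S. (norm (x i))\<^sup>2)"
    by (intro sum.cong refl sum.reindex_bij_betw) (simp add: permutes_imp_bij)
  also have "\<dots> = fact (card S) * (\<Sum>i\<in>S. (norm (x i))\<^sup>2)"
    using card_permutations[OF refl S] by simp
  finally have "card S * c j = fact (card S) * (\<Sum>i\<in>S. (norm (x i))\<^sup>2)" .
  moreover have "card S > 0" using S j by (auto simp: card_gt_0_iff)
  ultimately show ?thesis by (simp add: c_def field_simps)
qed

text \<open>
  Sampling without replacement from a population with mean zero is negatively correlated. All
  positions \<open>k \<noteq> j\<close> have the same correlation with position \<open>j\<close> and, because the population sums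
  to zero, these correlations add up to minus the variance at \<open>j\<close>.
\<close>

lemma sum_permutes_inner_nonpos:
  fixes x :: "'b \<Rightarrow> 'a::real_inner"
  assumes S: "finite S" and zero: "(\<Sum>i\<in>S. x i) = 0"
    and jk: "j \<in> S" "k \<in> S" "j \<noteq> k"
  shows "(\<Sum>p | p permutes S. x (p j) \<bullet> x (p k)) \<le> 0"
proof -
  define c where "c l = (\<Sum>p | p permutes S. x (p j) \<bullet> x (p l))" for l
  have c: "c l = c k" if "l \<in> S - {j}" for l
  proof -
    have "l \<in> S" "j \<noteq> l" using that by auto
    then show ?thesis
      unfolding c_def
      using sum_permutes_transpose[OF \<open>l \<in> S\<close> jk(2), of "\<lambda>p. x (p j) \<bullet> x (p l)"] jk by simp
  qed
  have "(\<Sum>l\<in>S. c l) = (\<Sum>p | p permutes S. x (p j) \<bullet> (\<Sum>l\<in>S. x (p l)))"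
    unfolding c_def inner_sum_right by (rule sum.swap)
  also have "\<dots> = 0"
  proof (intro sum.neutral ballI)
    fix p assume "p \<in> {p. p permutes S}"
    then have "(\<Sum>l\<in>S. x (p l)) = (\<Sum>i\<in>S. x i)"
      by (intro sum.reindex_bij_betw) (simp add: permutes_imp_bij)
    then show "x (p j) \<bullet> (\<Sum>l\<in>S. x (p l)) = 0" using zero by simp
  qed
  finally have "c j + (\<Sum>l\<in>S - {j}. c l) = 0"
    using S jk by (simp add: sum.remove)
  moreover have "(\<Sum>l\<in>S - {j}. c l) = card (S - {j}) * c k" using c by simp
  moreover have "c j \<ge> 0" unfolding c_def by (intro sum_nonneg) simp
  ultimately have "real (card (S - {j})) * c k \<le> 0" by linarith
  moreover have "card (S - {j}) > 0"
    unfolding card_gt_0_iff using S jk by auto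
  ultimately show ?thesis unfolding c_def by (simp add: mult_le_0_iff)
qed

text \<open>
  Consequently a partial sum of a random permutation has at most the variance that independent
  sampling would give.
\<close>

lemma sum_permutes_norm_sum_squared_le:
  fixes x :: "'b \<Rightarrow> 'a::real_inner"
  assumes S: "finite S" and zero: "(\<Sum>i\<in>S. x i) = 0" and J: "J \<subseteq> S"
  shows "(\<Sum>p | p permutes S. (norm (\<Sum>j\<in>J. x (p j)))\<^sup>2)
    \<le> card J * (fact (card S) / card S * (\<Sum>i\<in>S. (norm (x i))\<^sup>2))"
proof -
  have fin: "finite J" using S J by (rule rev_finite_subset)
  have "(\<Sum>p | p permutes S. (norm (\<Sum>j\<in>J. x (p j)))\<^sup>2)
      = (\<Sum>j\<in>J. \<Sum>k\<in>J. \<Sum>p | p permutes S. x (p j) \<bullet> x (p k))"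
    unfolding norm_sum_squared
    by (subst sum.swap, intro sum.cong refl, rule sum.swap)
  also have "\<dots> \<le> (\<Sum>j\<in>J. \<Sum>k\<in>J. if j = k
      then fact (card S) / card S * (\<Sum>i\<in>S. (norm (x i))\<^sup>2) else 0)"
    using J sum_permutes_inner_nonpos[OF S zero] sum_permutes_norm_squared[OF S, of _ x]
    by (intro sum_mono) (auto simp: power2_norm_eq_inner subset_iff)
  also have "\<dots> = card J * (fact (card S) / card S * (\<Sum>i\<in>S. (norm (x i))\<^sup>2))"
    using fin by (simp add: sum.delta')
  finally show ?thesis .
qed

section \<open>Drift of the iterates within an epoch\<close>

text \<open>
  Convexity with weights \<open>1 / 2\<close>, \<open>1 / 4\<close>, \<open>1 / 4\<close>: the leading term \<open>a\<close> gets the smallest constant.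
\<close>

lemma norm_weighted_sum3_squared_le:
  fixes a b c :: "'a::real_inner"
  shows "(norm (a + b + c))\<^sup>2 \<le> 2 * (norm a)\<^sup>2 + 4 * (norm b)\<^sup>2 + 4 * (norm c)\<^sup>2"
proof -
  have "0 \<le> (norm (a - 2 *\<^sub>R b))\<^sup>2 / 2 + (norm (a - 2 *\<^sub>R c))\<^sup>2 / 2 + (norm (b - c))\<^sup>2"
    by simp
  then show ?thesis
    unfolding power2_norm_eq_inner
    by (simp add: inner_simps inner_commute algebra_simps add_divide_distrib diff_divide_distrib)
qed

lemma norm_sum_squared_le_card:
  fixes x :: "'b \<Rightarrow> 'a::real_inner"
  assumes "finite J"
  shows "(norm (\<Sum>j\<in>J. x j))\<^sup>2 \<le> card J * (\<Sum>j\<in>J. (norm (x j))\<^sup>2)"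
proof -
  have "(norm (\<Sum>j\<in>J. x j))\<^sup>2 \<le> (\<Sum>j\<in>J. norm (x j) * 1)\<^sup>2"
    using norm_sum[of x J] by (simp add: power_mono)
  also have "\<dots> \<le> (\<Sum>j\<in>J. (norm (x j))\<^sup>2) * (\<Sum>j\<in>J. 1\<^sup>2)"
    by (rule Cauchy_Schwarz_ineq_sum)
  finally show ?thesis by (simp add: mult.commute)
qed

lemma norm_convex_combination_squared_le:
  fixes x y :: "'a::real_inner"
  assumes "0 \<le> \<beta>" "\<beta> \<le> 1"
  shows "(norm (\<beta> *\<^sub>R x + (1 - \<beta>) *\<^sub>R y))\<^sup>2 \<le> \<beta> * (norm x)\<^sup>2 + (1 - \<beta>) * (norm y)\<^sup>2"
proof -
  have "0 \<le> \<beta> * (1 - \<beta>) * (norm (x - y))\<^sup>2" using assms by simp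
  also have "\<dots> = \<beta> * (norm x)\<^sup>2 + (1 - \<beta>) * (norm y)\<^sup>2 - (norm (\<beta> *\<^sub>R x + (1 - \<beta>) *\<^sub>R y))\<^sup>2"
    unfolding power2_norm_eq_inner by (simp add: inner_simps inner_commute algebra_simps)
  finally show ?thesis by simp
qed

lemma sum_squares_lessThan_le: "(\<Sum>i<n. (real i)\<^sup>2) \<le> (real n) ^ 3 / 3"
proof (induction n)
  case (Suc n)
  then show ?case by (simp add: power2_eq_square power3_eq_cube field_simps)
qed simp

lemma sum_lessThan_le: "(\<Sum>i<n. real i) \<le> (real n)\<^sup>2 / 2"
proof (induction n)
  case (Suc n)
  then show ?case by (simp add: power2_eq_square field_simps)
qed simp

text \<open>
  The drift of the iterates within one epoch. Here \<open>d i\<close> is the displacement after \<open>i\<close> inner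
  steps, \<open>- u\<close> is the direction that the epoch would follow if all component gradients were equal
  to the full gradient at its starting point, \<open>e j\<close> is the error caused by evaluating gradient
  \<open>j\<close> at the current inner iterate instead of the starting point, and \<open>\<xi> j\<close> is the deviation of
  component gradient \<open>j\<close> from the full gradient at the starting point. The errors \<open>e\<close> are
  controlled by the drift itself, which is absorbed because \<open>L * \<eta>\<close> is small. The second bound
  measures the distance to the end of the epoch; it involves the suffix sums of \<open>\<xi>\<close>, which are
  the negatives of the prefix sums.
\<close>

lemma drift_bounds:
  fixes d e \<xi> :: "nat \<Rightarrow> 'a::real_inner" and u :: 'a
  assumes n: "n \<ge> 1" and \<beta>: "0 \<le> \<beta>" "\<beta> \<le> 1"
    and r: "L\<^sup>2 * \<eta>\<^sup>2 \<le> 1 / 30"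
    and d: "\<And>i. i \<le> n \<Longrightarrow>
      d i = - (\<eta> / real n) *\<^sub>R (real i *\<^sub>R u + (1 - \<beta>) *\<^sub>R (\<Sum>j<i. e j + \<xi> j))"
    and e: "\<And>j. j < n \<Longrightarrow> norm (e j) \<le> L * norm (d j)"
    and \<xi>: "(\<Sum>j<n. \<xi> j) = 0"
  defines "W \<equiv> (1 / real n ^ 3) * (\<Sum>i<n. (norm (\<Sum>j<i. \<xi> j))\<^sup>2)"
  shows "(1 / real n) * (\<Sum>i<n. (norm (d i))\<^sup>2) \<le> \<eta>\<^sup>2 * (3 / 4 * (norm u)\<^sup>2 + 9 / 2 * W)" (is ?A)
    and "(1 / real n) * (\<Sum>i<n. (norm (d n - d i))\<^sup>2) \<le> \<eta>\<^sup>2 * (9 / 4 * (norm u)\<^sup>2 + 5 * W)" (is ?B)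
proof -
  define A where "A = (1 / real n) * (\<Sum>i<n. (norm (d i))\<^sup>2)"
  have npos: "real n > 0" using n by simp
  have A0: "A \<ge> 0" unfolding A_def by (simp add: sum_nonneg)
  have W0: "W \<ge> 0" unfolding W_def by (simp add: sum_nonneg)
  have SW: "(\<Sum>i<n. (norm (\<Sum>j<i. \<xi> j))\<^sup>2) = real n ^ 3 * W"
    unfolding W_def using npos by simp
  have e_sum: "(norm (\<Sum>j\<in>J. e j))\<^sup>2 \<le> card J * (L\<^sup>2 * (real n * A))" if "J \<subseteq> {..<n}" for J
  proof -
    have "(norm (\<Sum>j\<in>J. e j))\<^sup>2 \<le> card J * (\<Sum>j\<in>J. (norm (e j))\<^sup>2)"
      using that by (intro norm_sum_squared_le_card) (rule finite_subset, auto)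
    also have "(\<Sum>j\<in>J. (norm (e j))\<^sup>2) \<le> (\<Sum>j<n. (norm (e j))\<^sup>2)"
      using that by (intro sum_mono2) auto
    also have "\<dots> \<le> (\<Sum>j<n. L\<^sup>2 * (norm (d j))\<^sup>2)"
      by (intro sum_mono) (metis e lessThan_iff norm_ge_zero power_mono power_mult_distrib)
    also have "\<dots> = L\<^sup>2 * (real n * A)"
      unfolding A_def using npos by (simp add: sum_distrib_left)
    finally show ?thesis by (simp add: mult_left_mono)
  qed
  have step: "(norm (- (\<eta> / real n) *\<^sub>R (k *\<^sub>R u + (1 - \<beta>) *\<^sub>R (a + b))))\<^sup>2
      \<le> (\<eta> / real n)\<^sup>2 * (2 * k\<^sup>2 * (norm u)\<^sup>2 + 4 * (norm a)\<^sup>2 + 4 * (norm b)\<^sup>2)" for k a b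
  proof -
    have q: "(1 - \<beta>)\<^sup>2 \<le> 1" using \<beta> by (simp add: power_le_one)
    have "(norm (k *\<^sub>R u + (1 - \<beta>) *\<^sub>R (a + b)))\<^sup>2
        \<le> 2 * (norm (k *\<^sub>R u))\<^sup>2 + 4 * (norm ((1 - \<beta>) *\<^sub>R a))\<^sup>2 + 4 * (norm ((1 - \<beta>) *\<^sub>R b))\<^sup>2"
      using norm_weighted_sum3_squared_le[of "k *\<^sub>R u" "(1 - \<beta>) *\<^sub>R a" "(1 - \<beta>) *\<^sub>R b"]
      by (simp add: algebra_simps)
    also have "\<dots> = 2 * k\<^sup>2 * (norm u)\<^sup>2 + (1 - \<beta>)\<^sup>2 * (4 * (norm a)\<^sup>2 + 4 * (norm b)\<^sup>2)"
      unfolding norm_scaleR power_mult_distrib power2_abs by (simp add: distrib_left)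
    also have "\<dots> \<le> 2 * k\<^sup>2 * (norm u)\<^sup>2 + 1 * (4 * (norm a)\<^sup>2 + 4 * (norm b)\<^sup>2)"
      by (intro add_left_mono mult_right_mono q) simp
    finally show ?thesis
      by (simp add: norm_minus_commute power_mult_distrib power_divide divide_right_mono mult_left_mono add.assoc)
  qed
  \<comment> \<open>Both claims are instances of one estimate: \<open>v i\<close> is a displacement over \<open>k i\<close> inner steps, with
    the steps in \<open>J i\<close>, and \<open>b i\<close> is a prefix sum of \<open>\<xi>\<close> up to sign.\<close>
  have bound: "(1 / real n) * (\<Sum>i<n. (norm (v i))\<^sup>2)
      \<le> \<eta>\<^sup>2 * (2 * c * (norm u)\<^sup>2 + 4 * c' * (L\<^sup>2 * A) + 4 * W)"
    if v: "\<And>i. i < n \<Longrightarrow> v i = - (\<eta> / real n) *\<^sub>R (k i *\<^sub>R u + (1 - \<beta>) *\<^sub>R ((\<Sum>j\<in>J i. e j) + b i))"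
      and J: "\<And>i. i < n \<Longrightarrow> J i \<subseteq> {..<n} \<and> real (card (J i)) \<le> k i"
      and b: "\<And>i. i < n \<Longrightarrow> norm (b i) = norm (\<Sum>j<i. \<xi> j)"
      and k: "(\<Sum>i<n. (k i)\<^sup>2) \<le> c * real n ^ 3" "(\<Sum>i<n. k i) \<le> c' * real n ^ 2"
    for v b :: "nat \<Rightarrow> 'a" and k :: "nat \<Rightarrow> real" and J c c'
  proof -
    have LA: "L\<^sup>2 * (real n * A) \<ge> 0" using A0 by simp
    have "(\<Sum>i<n. (norm (v i))\<^sup>2) \<le> (\<Sum>i<n. (\<eta> / real n)\<^sup>2 *
        (2 * (k i)\<^sup>2 * (norm u)\<^sup>2 + 4 * (k i * (L\<^sup>2 * (real n * A))) + 4 * (norm (\<Sum>j<i. \<xi> j))\<^sup>2))"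
    proof (intro sum_mono)
      fix i assume "i \<in> {..<n}"
      then have i: "i < n" by simp
      have "(norm (\<Sum>j\<in>J i. e j))\<^sup>2 \<le> card (J i) * (L\<^sup>2 * (real n * A))"
        using e_sum J[OF i] by blast
      also have "\<dots> \<le> k i * (L\<^sup>2 * (real n * A))"
        using J[OF i] LA by (intro mult_right_mono) auto
      finally have "(\<eta> / real n)\<^sup>2 * (2 * (k i)\<^sup>2 * (norm u)\<^sup>2 + 4 * (norm (\<Sum>j\<in>J i. e j))\<^sup>2
          + 4 * (norm (b i))\<^sup>2) \<le> (\<eta> / real n)\<^sup>2 *
        (2 * (k i)\<^sup>2 * (norm u)\<^sup>2 + 4 * (k i * (L\<^sup>2 * (real n * A))) + 4 * (norm (\<Sum>j<i. \<xi> j))\<^sup>2)"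
        using b[OF i] by (intro mult_left_mono) auto
      then show "(norm (v i))\<^sup>2 \<le> (\<eta> / real n)\<^sup>2 *
        (2 * (k i)\<^sup>2 * (norm u)\<^sup>2 + 4 * (k i * (L\<^sup>2 * (real n * A))) + 4 * (norm (\<Sum>j<i. \<xi> j))\<^sup>2)"
        using step[of "k i" "\<Sum>j\<in>J i. e j" "b i"] unfolding v[OF i] by linarith
    qed
    also have "\<dots> = (\<eta> / real n)\<^sup>2 * (2 * (\<Sum>i<n. (k i)\<^sup>2) * (norm u)\<^sup>2
        + 4 * ((\<Sum>i<n. k i) * (L\<^sup>2 * (real n * A))) + 4 * (real n ^ 3 * W))"
      by (simp add: sum.distrib SW flip: sum_distrib_left sum_distrib_right)
    also have "\<dots> \<le> (\<eta> / real n)\<^sup>2 * (2 * (c * real n ^ 3) * (norm u)\<^sup>2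
        + 4 * ((c' * real n ^ 2) * (L\<^sup>2 * (real n * A))) + 4 * (real n ^ 3 * W))"
      using k LA by (intro mult_left_mono add_mono mult_right_mono) auto
    also have "\<dots> = real n * (\<eta>\<^sup>2 * (2 * c * (norm u)\<^sup>2 + 4 * c' * (L\<^sup>2 * A) + 4 * W))"
      using npos by (simp add: field_simps power2_eq_square power3_eq_cube)
    finally show ?thesis using npos by (simp add: field_simps)
  qed
  have "A \<le> \<eta>\<^sup>2 * (2 * (1 / 3) * (norm u)\<^sup>2 + 4 * (1 / 2) * (L\<^sup>2 * A) + 4 * W)"
    using bound[where v = d and k = real and J = "\<lambda>i. {..<i}" and b = "\<lambda>i. \<Sum>j<i. \<xi> j" and c = "1 / 3" and c' = "1 / 2"]
      d sum_squares_lessThan_le[of n] sum_lessThan_le[of n]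
    by (auto simp: sum.distrib A_def)
  also have "\<dots> = \<eta>\<^sup>2 * (2 / 3 * (norm u)\<^sup>2 + 4 * W) + 2 * (L\<^sup>2 * \<eta>\<^sup>2) * A"
    by (simp add: algebra_simps)
  also have "\<dots> \<le> \<eta>\<^sup>2 * (2 / 3 * (norm u)\<^sup>2 + 4 * W) + 2 * (1 / 30) * A"
    using r A0 by (intro add_left_mono mult_right_mono) auto
  finally have "A \<le> 15 / 14 * (\<eta>\<^sup>2 * (2 / 3 * (norm u)\<^sup>2 + 4 * W))" by simp
  also have "\<dots> = \<eta>\<^sup>2 * (5 / 7 * (norm u)\<^sup>2 + 30 / 7 * W)" by (simp add: algebra_simps)
  also have "\<dots> \<le> \<eta>\<^sup>2 * (3 / 4 * (norm u)\<^sup>2 + 9 / 2 * W)"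
    using W0 by (intro mult_left_mono add_mono mult_right_mono) auto
  finally have A_le: "A \<le> \<eta>\<^sup>2 * (3 / 4 * (norm u)\<^sup>2 + 9 / 2 * W)" .
  then show ?A unfolding A_def .

  have diff: "d n - d i = - (\<eta> / real n) *\<^sub>R (real (n - i) *\<^sub>R u
      + (1 - \<beta>) *\<^sub>R ((\<Sum>j\<in>{i..<n}. e j) + - (\<Sum>j<i. \<xi> j)))" if "i < n" for i
  proof -
    have split: "(\<Sum>j<n. h j) = (\<Sum>j<i. h j) + (\<Sum>j\<in>{i..<n}. h j)" for h :: "nat \<Rightarrow> 'a"
      using that by (metis lessThan_atLeast0 less_imp_le sum.atLeastLessThan_concat zero_le)
    have "(\<Sum>j<n. e j + \<xi> j) = (\<Sum>j<i. e j + \<xi> j) + ((\<Sum>j\<in>{i..<n}. e j) + - (\<Sum>j<i. \<xi> j))"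
      using split[of e] \<xi> by (simp add: sum.distrib)
    moreover have "- c *\<^sub>R (real n *\<^sub>R u + b *\<^sub>R (s + t)) - (- c *\<^sub>R (real i *\<^sub>R u + b *\<^sub>R s))
        = - c *\<^sub>R (real (n - i) *\<^sub>R u + b *\<^sub>R t)" for b c and s t :: 'a
      using that by (simp add: of_nat_diff algebra_simps)
    ultimately show ?thesis
      using that d[of n] d[of i] by simp
  qed
  have "(\<Sum>i<n. (norm (d n - d i))\<^sup>2) / real n
      \<le> \<eta>\<^sup>2 * (2 * (norm u)\<^sup>2 + 4 * (L\<^sup>2 * A) + 4 * W)"
  proof -
    have "(\<Sum>i<n. (real (n - i))\<^sup>2) \<le> (\<Sum>i<n. (real n)\<^sup>2)"
      by (intro sum_mono power_mono) auto
    moreover have "(\<Sum>i<n. real (n - i)) \<le> (\<Sum>i<n. real n)"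
      by (intro sum_mono) auto
    moreover have "{i..<n} \<subseteq> {..<n}" for i by auto
    ultimately show ?thesis
      using bound[where v = "\<lambda>i. d n - d i" and k = "\<lambda>i. real (n - i)" and J = "\<lambda>i. {i..<n}"
          and b = "\<lambda>i. - (\<Sum>j<i. \<xi> j)" and c = 1 and c' = 1, OF diff]
      by (auto simp: power2_eq_square power3_eq_cube)
  qed
  also have "\<dots> = \<eta>\<^sup>2 * (2 * (norm u)\<^sup>2 + 4 * W) + 4 * (L\<^sup>2 * \<eta>\<^sup>2) * A"
    by (simp add: algebra_simps)
  also have "\<dots> \<le> \<eta>\<^sup>2 * (2 * (norm u)\<^sup>2 + 4 * W) + 4 * (1 / 30) * A"
    using r A0 by (intro add_left_mono mult_right_mono) auto
  also have "\<dots> \<le> \<eta>\<^sup>2 * (2 * (norm u)\<^sup>2 + 4 * W)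
      + 4 * (1 / 30) * (\<eta>\<^sup>2 * (3 / 4 * (norm u)\<^sup>2 + 9 / 2 * W))"
    using A_le by simp
  also have "\<dots> = \<eta>\<^sup>2 * (21 / 10 * (norm u)\<^sup>2 + 23 / 5 * W)" by (simp add: algebra_simps)
  also have "\<dots> \<le> \<eta>\<^sup>2 * (9 / 4 * (norm u)\<^sup>2 + 5 * W)"
    using W0 by (intro mult_left_mono add_mono mult_right_mono) auto
  finally show ?B by simp
qed

section \<open>Gradients of smooth functions\<close>

lemma GDERIV_unique:
  assumes "GDERIV F x :> a" "GDERIV F x :> b"
  shows "a = b"
proof -
  have "(\<lambda>h. h \<bullet> a) = (\<lambda>h. h \<bullet> b)"
    using assms unfolding gderiv_def by (rule has_derivative_unique)
  then have "(a - b) \<bullet> (a - b) = 0"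
    by (metis inner_diff_right right_minus_eq)
  then show ?thesis by simp
qed

lemma GDERIV_imp_grad: "GDERIV F x :> a \<Longrightarrow> grad F x = a"
  unfolding grad_def by (rule the_equality) (auto intro: GDERIV_unique)

lemma smooth_descent:
  fixes F :: "'a::real_inner \<Rightarrow> real"
  assumes G: "\<And>z. GDERIV F z :> G z"
    and lip: "\<And>y z. norm (G y - G z) \<le> L * norm (y - z)"
  shows "F (x + h) \<le> F x + G x \<bullet> h + L / 2 * (norm h)\<^sup>2"
proof -
  define \<phi> where "\<phi> s = F (x + s *\<^sub>R h) - s * (G x \<bullet> h) - L / 2 * s\<^sup>2 * (norm h)\<^sup>2" for s
  have der: "(\<phi> has_real_derivative (G (x + s *\<^sub>R h) \<bullet> h - G x \<bullet> h - L * s * (norm h)\<^sup>2)) (at s)" for s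
  proof -
    have "((\<lambda>s. x + s *\<^sub>R h) has_derivative (\<lambda>k. k *\<^sub>R h)) (at s)"
      by (auto intro!: derivative_eq_intros)
    then have "((\<lambda>s. F (x + s *\<^sub>R h)) has_derivative (\<lambda>k. (k *\<^sub>R h) \<bullet> G (x + s *\<^sub>R h))) (at s)"
      using G[of "x + s *\<^sub>R h"] unfolding gderiv_def
      using has_derivative_compose[of "\<lambda>s. x + s *\<^sub>R h" _ s UNIV F] by blast
    then have "((\<lambda>s. F (x + s *\<^sub>R h)) has_real_derivative (G (x + s *\<^sub>R h) \<bullet> h)) (at s)"
      by (simp add: has_field_derivative_def inner_commute mult_commute_abs)
    then show ?thesis
      unfolding \<phi>_def by (auto intro!: derivative_eq_intros)
  qed
  have "\<phi> 1 \<le> \<phi> 0"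
  proof (rule DERIV_nonpos_imp_nonincreasing[of 0 1 \<phi>])
    fix s :: real assume s: "0 \<le> s" "s \<le> 1"
    have "(G (x + s *\<^sub>R h) - G x) \<bullet> h \<le> norm (G (x + s *\<^sub>R h) - G x) * norm h"
      by (rule norm_cauchy_schwarz)
    also have "\<dots> \<le> (L * norm (s *\<^sub>R h)) * norm h"
      using lip[of "x + s *\<^sub>R h" x] by (intro mult_right_mono) auto
    also have "\<dots> = L * s * (norm h)\<^sup>2" using s by (simp add: power2_eq_square)
    finally show "\<exists>y. DERIV \<phi> s :> y \<and> y \<le> 0"
      using der[of s] by (auto simp: inner_diff_left)
  qed simp
  then show ?thesis by (simp add: \<phi>_def)
qed

section \<open>One epoch of the algorithm\<close>

text \<open>
  The accumulated deviation that the order \<open>p\<close> causes at the point \<open>x\<close>: the squared norms of the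
  prefix sums of \<open>\<nabla>f\<^bsub>p(j)\<^esub>(x) - \<nabla>F(x)\<close>, normalised by \<open>n\<^sup>3\<close>. The normalisation makes it the mean over
  the prefixes of \<open>\<parallel>prefix sum / n\<parallel>\<^sup>2\<close>. Permutations act on \<open>{1..n}\<close>, hence the index shift.
\<close>

definition shuffling_deviation ::
  "(nat \<Rightarrow> 'a::real_inner \<Rightarrow> real) \<Rightarrow> ('a \<Rightarrow> real) \<Rightarrow> nat \<Rightarrow> (nat \<Rightarrow> nat) \<Rightarrow> 'a \<Rightarrow> real" where
  "shuffling_deviation f F n p x =
    (1 / real n ^ 3) * (\<Sum>i<n. (norm (\<Sum>j<i. grad (f (p (j + 1))) x - grad F x))\<^sup>2)"

text \<open>
  Within an epoch the momentum weight always multiplies the initial momentum, so the inner iterates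
  are explicit in terms of the gradients \<open>g j\<close> that were used.
\<close>

lemma smg_epoch_closed_form:
  fixes f :: "nat \<Rightarrow> 'a::real_inner \<Rightarrow> real" and \<beta> \<eta> :: real and p :: "nat \<Rightarrow> nat"
    and w0 m0 :: 'a and n :: nat
  defines "g \<equiv> \<lambda>j. grad (f (p (j + 1))) (fst (smg_epoch f n \<beta> \<eta> p w0 m0 j))"
  shows "fst (smg_epoch f n \<beta> \<eta> p w0 m0 i) = w0 - (\<eta> / real n) *\<^sub>R
      ((real i * \<beta>) *\<^sub>R m0 + (1 - \<beta>) *\<^sub>R (\<Sum>j<i. g j))"
    and "snd (snd (smg_epoch f n \<beta> \<eta> p w0 m0 i)) = (1 / real n) *\<^sub>R (\<Sum>j<i. g j)"
proof (induction i)
  case (Suc i)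
  case 1
  show ?case using Suc(1)
    by (simp add: case_prod_unfold Let_def g_def algebra_simps)
next
  case (Suc i)
  case 2
  show ?case using Suc(2)
    by (simp add: case_prod_unfold Let_def g_def algebra_simps)
qed simp_all

text \<open>
  The objective \<open>F\<close> is the mean of \<open>n\<close> differentiable components with \<open>L\<close>-Lipschitz gradients.
\<close>

locale smooth_finite_sum =
  fixes f :: "nat \<Rightarrow> 'a::euclidean_space \<Rightarrow> real"
    and F :: "'a \<Rightarrow> real" and n :: nat and L :: real
  assumes n: "n \<ge> 1"
    and F: "F = (\<lambda>x. (1 / real n) * (\<Sum>i=1..n. f i x))"
    and f_diff: "\<And>i x. i \<in> {1..n} \<Longrightarrow> f i differentiable (at x)"
    and f_smooth: "\<And>i x y. i \<in> {1..n} \<Longrightarrow>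
      norm (grad (f i) x - grad (f i) y) \<le> L * norm (x - y)"
begin

lemma grad_F: "grad F x = (1 / real n) *\<^sub>R (\<Sum>i=1..n. grad (f i) x)"
  and GDERIV_F: "GDERIV F x :> grad F x"
proof -
  have "((\<lambda>x. (1 / real n) * (\<Sum>i=1..n. f i x)) has_derivative
      (\<lambda>h. (1 / real n) * (\<Sum>i=1..n. h \<bullet> grad (f i) x))) (at x)"
    using GDERIV_grad[OF f_diff] unfolding gderiv_def
    by (intro has_derivative_mult_right has_derivative_sum) blast
  then have *: "GDERIV F x :> (1 / real n) *\<^sub>R (\<Sum>i=1..n. grad (f i) x)"
    by (simp add: F gderiv_def inner_sum_right)
  show "grad F x = (1 / real n) *\<^sub>R (\<Sum>i=1..n. grad (f i) x)"
    by (rule GDERIV_imp_grad[OF *])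
  then show "GDERIV F x :> grad F x" using * by simp
qed

lemma sum_grad_deviation: "(\<Sum>i=1..n. grad (f i) x - grad F x) = 0"
  using n by (simp add: sum_subtractf grad_F sum_constant_scaleR)

lemma grad_F_lipschitz: "norm (grad F x - grad F y) \<le> L * norm (x - y)"
proof -
  have "norm (grad F x - grad F y) = (1 / real n) * norm (\<Sum>i=1..n. grad (f i) x - grad (f i) y)"
    by (simp add: grad_F sum_subtractf flip: scaleR_diff_right)
  also have "\<dots> \<le> (1 / real n) * (\<Sum>i=1..n. L * norm (x - y))"
    by (intro mult_left_mono sum_norm_le f_smooth) auto
  also have "\<dots> = L * norm (x - y)" using n by simp
  finally show ?thesis .
qed

lemma F_descent: "F (x + h) \<le> F x + grad F x \<bullet> h + L / 2 * (norm h)\<^sup>2"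
  by (rule smooth_descent[OF GDERIV_F grad_F_lipschitz])

lemma sum_permuted:
  fixes h :: "nat \<Rightarrow> 'b::comm_monoid_add"
  assumes "p permutes {1..n}"
  shows "(\<Sum>j<n. h (p (j + 1))) = (\<Sum>i=1..n. h i)"
proof -
  have "(\<Sum>i=1..n. h i) = (\<Sum>i=1..n. h (p i))"
    using sum.reindex_bij_betw[OF permutes_imp_bij[OF assms], of h] by simp
  also have "\<dots> = (\<Sum>j<n. h (p (j + 1)))"
    by (rule sum.reindex_bij_witness[of _ "\<lambda>j. j + 1" "\<lambda>i. i - 1"]) auto
  finally show ?thesis by simp
qed

lemma permuted_index: "p permutes {1..n} \<Longrightarrow> j < n \<Longrightarrow> p (j + 1) \<in> {1..n}"
  using permutes_in_image[of p "{1..n}" "j + 1"] by simp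

text \<open>
  One epoch that starts at \<open>w0\<close> with momentum \<open>m0\<close> and ends at \<open>w1\<close> with averaged gradient \<open>v1\<close>.
\<close>

context
  fixes \<beta> \<eta> :: real and p :: "nat \<Rightarrow> nat" and w0 m0 w1 m1 v1 :: 'a
  assumes \<beta>: "0 \<le> \<beta>" "\<beta> \<le> 1" and \<eta>: "\<eta> \<ge> 0" and r: "L\<^sup>2 * \<eta>\<^sup>2 \<le> 1 / 30"
    and p: "p permutes {1..n}"
    and epoch: "smg_epoch f n \<beta> \<eta> p w0 m0 n = (w1, m1, v1)"
begin

lemma epoch_update: "w1 = w0 - \<eta> *\<^sub>R (\<beta> *\<^sub>R m0 + (1 - \<beta>) *\<^sub>R v1)"
  using smg_epoch_closed_form[of f n \<beta> \<eta> p w0 m0 n] n epoch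
  by (simp add: scaleR_add_right mult.commute)

text \<open>
  The averaged gradient of the epoch approximates the full gradient at both ends of the epoch. The
  approximation at the end is the momentum error with which the next epoch starts.
\<close>

lemma epoch_gradient_errors:
  defines "W \<equiv> shuffling_deviation f F n p w0"
    and "Z \<equiv> (norm (\<beta> *\<^sub>R m0 + (1 - \<beta>) *\<^sub>R grad F w0))\<^sup>2"
  shows "(norm (grad F w0 - v1))\<^sup>2 \<le> L\<^sup>2 * \<eta>\<^sup>2 * (3 / 4 * Z + 9 / 2 * W)"
    and "(norm (grad F w1 - v1))\<^sup>2 \<le> L\<^sup>2 * \<eta>\<^sup>2 * (9 / 4 * Z + 5 * W)"
proof -
  define y where "y i = fst (smg_epoch f n \<beta> \<eta> p w0 m0 i)" for i
  define g where "g j = grad (f (p (j + 1))) (y j)" for j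
  define \<xi> where "\<xi> j = grad (f (p (j + 1))) w0 - grad F w0" for j
  define e where "e j = g j - grad (f (p (j + 1))) w0" for j
  define d where "d i = y i - w0" for i
  have yn: "y n = w1" using epoch by (simp add: y_def)
  have v1: "v1 = (1 / real n) *\<^sub>R (\<Sum>j<n. g j)"
    using smg_epoch_closed_form(2)[of f n \<beta> \<eta> p w0 m0 n] epoch by (simp add: g_def y_def)
  have d: "d i = - (\<eta> / real n) *\<^sub>R (real i *\<^sub>R (\<beta> *\<^sub>R m0 + (1 - \<beta>) *\<^sub>R grad F w0)
      + (1 - \<beta>) *\<^sub>R (\<Sum>j<i. e j + \<xi> j))" for i
  proof -
    have "(\<Sum>j<i. g j) = (\<Sum>j<i. e j + \<xi> j) + real i *\<^sub>R grad F w0"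
      by (simp add: e_def \<xi>_def sum_subtractf sum_constant_scaleR)
    then have "real i *\<^sub>R (\<beta> *\<^sub>R m0 + (1 - \<beta>) *\<^sub>R grad F w0) + (1 - \<beta>) *\<^sub>R (\<Sum>j<i. e j + \<xi> j)
        = (real i * \<beta>) *\<^sub>R m0 + (1 - \<beta>) *\<^sub>R (\<Sum>j<i. g j)"
      by (simp add: algebra_simps)
    then show ?thesis
      using smg_epoch_closed_form(1)[of f n \<beta> \<eta> p w0 m0 i]
      by (simp add: d_def y_def g_def)
  qed
  have e: "norm (e j) \<le> L * norm (d j)" if "j < n" for j
    unfolding e_def g_def d_def using f_smooth[OF permuted_index[OF p that]] by simp
  have \<xi>: "(\<Sum>j<n. \<xi> j) = 0"
    unfolding \<xi>_def
    using sum_permuted[OF p, of "\<lambda>i. grad (f i) w0 - grad F w0"] sum_grad_deviation by simp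
  have W: "W = (1 / real n ^ 3) * (\<Sum>i<n. (norm (\<Sum>j<i. \<xi> j))\<^sup>2)"
    unfolding W_def shuffling_deviation_def \<xi>_def ..
  \<comment> \<open>By smoothness, the squared distance of \<open>v1\<close> from the full gradient at \<open>x\<close> is at most \<open>L\<^sup>2\<close>
    times the mean squared distance of \<open>x\<close> from the inner iterates.\<close>
  have error: "(norm (grad F x - v1))\<^sup>2 \<le> L\<^sup>2 * ((1 / real n) * (\<Sum>j<n. (norm (x - y j))\<^sup>2))" for x
  proof -
    have "grad F x - v1 = (1 / real n) *\<^sub>R (\<Sum>j<n. grad (f (p (j + 1))) x - g j)"
      using sum_permuted[OF p, of "\<lambda>i. grad (f i) x"]
      by (simp add: grad_F v1 sum_subtractf flip: scaleR_diff_right)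
    then have "(norm (grad F x - v1))\<^sup>2
        = (1 / real n)\<^sup>2 * (norm (\<Sum>j<n. grad (f (p (j + 1))) x - g j))\<^sup>2"
      by (simp add: power_divide)
    also have "\<dots> \<le> (1 / real n)\<^sup>2 * (real n * (\<Sum>j<n. (norm (grad (f (p (j + 1))) x - g j))\<^sup>2))"
      using norm_sum_squared_le_card[of "{..<n}" "\<lambda>j. grad (f (p (j + 1))) x - g j"]
      by (intro mult_left_mono) auto
    also have "\<dots> \<le> (1 / real n)\<^sup>2 * (real n * (\<Sum>j<n. (L * norm (x - y j))\<^sup>2))"
      unfolding g_def by (intro mult_left_mono sum_mono power_mono f_smooth permuted_index[OF p]) auto
    also have "\<dots> = L\<^sup>2 * ((1 / real n) * (\<Sum>j<n. (norm (x - y j))\<^sup>2))"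
      unfolding power_mult_distrib sum_distrib_left[symmetric]
      using n by (simp add: power2_eq_square)
    finally show ?thesis .
  qed
  have drift: "(1 / real n) * (\<Sum>i<n. (norm (d i))\<^sup>2) \<le> \<eta>\<^sup>2 * (3 / 4 * Z + 9 / 2 * W)"
    "(1 / real n) * (\<Sum>i<n. (norm (d n - d i))\<^sup>2) \<le> \<eta>\<^sup>2 * (9 / 4 * Z + 5 * W)"
    unfolding W Z_def by (rule drift_bounds[OF n \<beta> r d _ \<xi>], erule e)+
  have "(norm (grad F w0 - v1))\<^sup>2 \<le> L\<^sup>2 * ((1 / real n) * (\<Sum>i<n. (norm (d i))\<^sup>2))"
    using error[of w0] by (simp add: d_def norm_minus_commute)
  also have "\<dots> \<le> L\<^sup>2 * (\<eta>\<^sup>2 * (3 / 4 * Z + 9 / 2 * W))"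
    by (intro mult_left_mono drift) simp
  finally show "(norm (grad F w0 - v1))\<^sup>2 \<le> L\<^sup>2 * \<eta>\<^sup>2 * (3 / 4 * Z + 9 / 2 * W)"
    by (simp only: mult.assoc)
  have "(norm (grad F w1 - v1))\<^sup>2 \<le> L\<^sup>2 * ((1 / real n) * (\<Sum>i<n. (norm (d n - d i))\<^sup>2))"
    using error[of w1] by (simp add: d_def yn)
  also have "\<dots> \<le> L\<^sup>2 * (\<eta>\<^sup>2 * (9 / 4 * Z + 5 * W))"
    by (intro mult_left_mono drift) simp
  finally show "(norm (grad F w1 - v1))\<^sup>2 \<le> L\<^sup>2 * \<eta>\<^sup>2 * (9 / 4 * Z + 5 * W)"
    by (simp only: mult.assoc)
qed

lemma epoch_descent:
  "F w1 \<le> F w0 - \<eta> / 2 * (norm (grad F w0))\<^sup>2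
    + \<eta> / 2 * (\<beta> * (norm (grad F w0 - m0))\<^sup>2 + (1 - \<beta>) * (norm (grad F w0 - v1))\<^sup>2)"
proof -
  define d where "d = \<beta> *\<^sub>R m0 + (1 - \<beta>) *\<^sub>R v1"
  have "(L * \<eta>)\<^sup>2 \<le> 1\<^sup>2" using r by (simp add: power_mult_distrib)
  then have L\<eta>: "L * \<eta> \<le> 1" by (rule power2_le_imp_le) simp
  have "F w1 \<le> F w0 + grad F w0 \<bullet> (- \<eta> *\<^sub>R d) + L / 2 * (norm (- \<eta> *\<^sub>R d))\<^sup>2"
    using F_descent[of w0 "- \<eta> *\<^sub>R d"] epoch_update by (simp add: d_def)
  also have "\<dots> = F w0 - \<eta> / 2 * (norm (grad F w0))\<^sup>2 + \<eta> / 2 * (norm (grad F w0 - d))\<^sup>2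
      - \<eta> / 2 * (1 - L * \<eta>) * (norm d)\<^sup>2"
  proof -
    have inner: "grad F w0 \<bullet> d = ((norm (grad F w0))\<^sup>2 + (norm d)\<^sup>2 - (norm (grad F w0 - d))\<^sup>2) / 2"
      unfolding power2_norm_eq_inner by (simp add: inner_simps inner_commute)
    have "(norm (- \<eta> *\<^sub>R d))\<^sup>2 = \<eta>\<^sup>2 * (norm d)\<^sup>2"
      by (simp add: power_mult_distrib)
    then show ?thesis
      unfolding inner_scaleR_right inner by (simp only:) (simp add: field_simps power2_eq_square)
  qed
  also have "\<dots> \<le> F w0 - \<eta> / 2 * (norm (grad F w0))\<^sup>2 + \<eta> / 2 * (norm (grad F w0 - d))\<^sup>2"
    using L\<eta> \<eta> by simp
  also have "grad F w0 - d = \<beta> *\<^sub>R (grad F w0 - m0) + (1 - \<beta>) *\<^sub>R (grad F w0 - v1)"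
    by (simp add: d_def algebra_simps)
  also have "(norm \<dots>)\<^sup>2 \<le> \<beta> * (norm (grad F w0 - m0))\<^sup>2 + (1 - \<beta>) * (norm (grad F w0 - v1))\<^sup>2"
    by (rule norm_convex_combination_squared_le[OF \<beta>])
  finally show ?thesis using \<eta> by (simp add: mult_left_mono)
qed

text \<open>
  The Lyapunov function is the objective plus \<open>2 / 3 * \<eta>\<close> times the squared momentum error \<open>x\<close>.
  The weight \<open>2 / 3\<close> leaves room for three contributions to the coefficient of \<open>x\<close>: \<open>\<beta> / 2\<close> from
  the descent step, and two terms of size at most \<open>1 / 30\<close> times a constant from the errors of the
  new averaged gradient. In the first epoch \<open>m0 = 0\<close> and the momentum error is the full gradient
  itself; it is then charged to the gradient term, which shrinks from \<open>\<eta> / 2\<close> to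
  \<open>\<eta> * (1 - \<beta>) / 2\<close>, and \<open>x = 0\<close> is used instead.
\<close>

lemma epoch_lyapunov_decrease:
  defines "W \<equiv> shuffling_deviation f F n p w0"
    and "G \<equiv> (norm (grad F w0))\<^sup>2"
  assumes x: "x = (norm (grad F w0 - m0))\<^sup>2 \<or> m0 = 0 \<and> x = 0"
  shows "F w1 + 2 / 3 * \<eta> * (norm (grad F w1 - v1))\<^sup>2
    \<le> F w0 + 2 / 3 * \<eta> * x - \<eta> * ((1 - \<beta>) / 2) * G
      + \<eta> * (L\<^sup>2 * \<eta>\<^sup>2) * (((1 - \<beta>) * (9 / 16) + 9 / 4) * G + ((1 - \<beta>) * (9 / 4) + 10 / 3) * W)"
proof -
  define r where "r = L\<^sup>2 * \<eta>\<^sup>2"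
  define Y where "Y = (norm (grad F w0 - v1))\<^sup>2"
  define X where "X = (norm (grad F w1 - v1))\<^sup>2"
  define Z where "Z = (norm (\<beta> *\<^sub>R m0 + (1 - \<beta>) *\<^sub>R grad F w0))\<^sup>2"
  have r01: "0 \<le> r" "r \<le> 1 / 30" using r by (auto simp: r_def)
  have x0: "x \<ge> 0" using x by auto
  have W0: "W \<ge> 0" unfolding W_def shuffling_deviation_def by (simp add: sum_nonneg)
  have G0: "G \<ge> 0" unfolding G_def by simp
  have Z: "Z \<le> 3 / 2 * G + 3 * x"
  proof (cases "m0 = 0 \<and> x = 0")
    case True
    have "(1 - \<beta>)\<^sup>2 * G \<le> 1 * G"
      using \<beta> G0 by (intro mult_right_mono) (auto simp: power_le_one)
    moreover have "Z = (1 - \<beta>)\<^sup>2 * G"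
      using True by (simp add: Z_def G_def power_mult_distrib)
    ultimately show ?thesis using True G0 by linarith
  next
    case False
    define \<delta> where "\<delta> = m0 - grad F w0"
    have x': "x = (norm \<delta>)\<^sup>2" using False x by (auto simp: \<delta>_def norm_minus_commute)
    have "Z = (norm (grad F w0 + \<beta> *\<^sub>R \<delta>))\<^sup>2"
      unfolding Z_def \<delta>_def by (simp add: algebra_simps)
    also have "\<dots> \<le> 3 / 2 * G + 3 * (norm (\<beta> *\<^sub>R \<delta>))\<^sup>2"
    proof -
      \<comment> \<open>Young's inequality in the form \<open>\<parallel>a + b\<parallel>\<^sup>2 \<le> 3 / 2 * \<parallel>a\<parallel>\<^sup>2 + 3 * \<parallel>b\<parallel>\<^sup>2\<close>\<close>
      have "0 \<le> (norm (grad F w0 - 2 *\<^sub>R (\<beta> *\<^sub>R \<delta>)))\<^sup>2" by simp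
      then show ?thesis
        unfolding G_def power2_norm_eq_inner by (simp add: inner_simps inner_commute)
    qed
    also have "(norm (\<beta> *\<^sub>R \<delta>))\<^sup>2 \<le> 1 * x"
      unfolding x' norm_scaleR power_mult_distrib power2_abs
      using \<beta> by (intro mult_right_mono) (auto simp: power_le_one)
    finally show ?thesis by simp
  qed
  have Y: "Y \<le> r * (9 / 8 * G + 9 / 4 * x + 9 / 2 * W)"
  proof -
    have "Y \<le> r * (3 / 4 * Z + 9 / 2 * W)"
      using epoch_gradient_errors(1) unfolding Y_def r_def Z_def W_def .
    also have "\<dots> \<le> r * (3 / 4 * (3 / 2 * G + 3 * x) + 9 / 2 * W)"
      using Z r01 by (intro mult_left_mono add_mono) auto
    finally show ?thesis by (simp add: algebra_simps)
  qed
  have X: "X \<le> r * (27 / 8 * G + 27 / 4 * x + 5 * W)"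
  proof -
    have "X \<le> r * (9 / 4 * Z + 5 * W)"
      using epoch_gradient_errors(2) unfolding X_def r_def Z_def W_def .
    also have "\<dots> \<le> r * (9 / 4 * (3 / 2 * G + 3 * x) + 5 * W)"
      using Z r01 by (intro mult_left_mono add_mono) auto
    finally show ?thesis by (simp add: algebra_simps)
  qed
  have "F w1 \<le> F w0 + \<eta> * (- (1 - \<beta>) / 2 * G + (\<beta> / 2 * x + (1 - \<beta>) / 2 * Y))"
  proof -
    have "\<beta> * (norm (grad F w0 - m0))\<^sup>2 - G \<le> \<beta> * x - (1 - \<beta>) * G"
      using x \<beta> G0 by (auto simp: G_def algebra_simps)
    then have "\<eta> / 2 * (\<beta> * (norm (grad F w0 - m0))\<^sup>2 - G + (1 - \<beta>) * Y)
        \<le> \<eta> / 2 * (\<beta> * x - (1 - \<beta>) * G + (1 - \<beta>) * Y)"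
      using \<eta> by (intro mult_left_mono) auto
    then show ?thesis
      using epoch_descent unfolding Y_def[symmetric] G_def[symmetric] by (simp add: field_simps)
  qed
  then have "F w1 + 2 / 3 * \<eta> * X
      \<le> F w0 + \<eta> * (- (1 - \<beta>) / 2 * G + (\<beta> / 2 * x + (1 - \<beta>) / 2 * Y + 2 / 3 * X))"
    by (simp add: algebra_simps)
  also have "\<dots> \<le> F w0 + \<eta> * (- (1 - \<beta>) / 2 * G + (2 / 3 * x
      + r * (((1 - \<beta>) * (9 / 16) + 9 / 4) * G + ((1 - \<beta>) * (9 / 4) + 10 / 3) * W)))"
  proof -
    have "(1 - \<beta>) / 2 * Y \<le> (1 - \<beta>) / 2 * (r * (9 / 8 * G + 9 / 4 * x + 9 / 2 * W))"
      using Y \<beta> by (intro mult_left_mono) auto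
    moreover have "r * ((1 - \<beta>) * (9 / 8) + 9 / 2) * x + \<beta> / 2 * x \<le> 2 / 3 * x"
    proof -
      have "r * ((1 - \<beta>) * (9 / 8) + 9 / 2) \<le> 1 / 30 * ((1 - \<beta>) * (9 / 8) + 9 / 2)"
        using r01 \<beta> by (intro mult_right_mono) auto
      moreover have "1 / 30 * ((1 - \<beta>) * (9 / 8) + 9 / 2) + \<beta> / 2 \<le> 2 / 3"
        using \<beta> by (simp add: field_simps)
      ultimately have "r * ((1 - \<beta>) * (9 / 8) + 9 / 2) + \<beta> / 2 \<le> 2 / 3" by linarith
      from mult_right_mono[OF this x0] show ?thesis by (simp add: algebra_simps)
    qed
    ultimately have "\<beta> / 2 * x + (1 - \<beta>) / 2 * Y + 2 / 3 * X \<le> 2 / 3 * x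
      + r * (((1 - \<beta>) * (9 / 16) + 9 / 4) * G + ((1 - \<beta>) * (9 / 4) + 10 / 3) * W)"
      using X by (simp add: algebra_simps add_divide_distrib diff_divide_distrib)
    then show ?thesis using \<eta> by (intro add_left_mono mult_left_mono) auto
  qed
  finally show ?thesis
    unfolding X_def r_def by (simp add: algebra_simps add_divide_distrib diff_divide_distrib)
qed

end

text \<open>
  Telescoping the Lyapunov function along a trajectory with arbitrary permutations \<open>q t\<close>. Randomness
  enters only afterwards, through the expectation of the shuffling deviations.
\<close>

lemma smg_trajectory_bound:
  fixes \<beta> Fstar :: real and \<eta> :: "nat \<Rightarrow> real" and q :: "nat \<Rightarrow> nat \<Rightarrow> nat" and w0 :: 'a
  assumes \<beta>: "0 \<le> \<beta>" "\<beta> \<le> 1"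
    and \<eta>_nonneg: "\<And>t. t \<ge> 1 \<Longrightarrow> 0 \<le> \<eta> t"
    and \<eta>_mono: "\<And>t. t \<ge> 1 \<Longrightarrow> \<eta> (t + 1) \<le> \<eta> t"
    and r: "\<And>t. t \<ge> 1 \<Longrightarrow> L\<^sup>2 * (\<eta> t)\<^sup>2 \<le> 1 / 30"
    and q: "\<And>t. t \<in> {1..T} \<Longrightarrow> q t permutes {1..n}"
    and Fstar: "\<And>x. Fstar \<le> F x"
  defines "w \<equiv> smg_iterate f n \<beta> \<eta> q w0"
  shows "(\<Sum>t=1..T. \<eta> t * ((1 - \<beta>) / 2) * (norm (grad F (w (t - 1))))\<^sup>2)
    \<le> F w0 - Fstar + (\<Sum>t=1..T. \<eta> t * (L\<^sup>2 * (\<eta> t)\<^sup>2) *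
        (((1 - \<beta>) * (9 / 16) + 9 / 4) * (norm (grad F (w (t - 1))))\<^sup>2
          + ((1 - \<beta>) * (9 / 4) + 10 / 3) * shuffling_deviation f F n (q t) (w (t - 1))))"
proof -
  define m where "m t = snd (smg_state f n \<beta> \<eta> q w0 t)" for t
  \<comment> \<open>the squared momentum error, set to zero before the first epoch\<close>
  define gap where "gap t = (if t = 0 then 0 else (norm (grad F (w t) - m t))\<^sup>2)" for t
  define lhs where "lhs t = \<eta> t * ((1 - \<beta>) / 2) * (norm (grad F (w (t - 1))))\<^sup>2" for t
  define rhs where "rhs t = \<eta> t * (L\<^sup>2 * (\<eta> t)\<^sup>2) *
        (((1 - \<beta>) * (9 / 16) + 9 / 4) * (norm (grad F (w (t - 1))))\<^sup>2
          + ((1 - \<beta>) * (9 / 4) + 10 / 3) * shuffling_deviation f F n (q t) (w (t - 1)))" for t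
  have "F (w k) + 2 / 3 * \<eta> (k + 1) * gap k + (\<Sum>t=1..k. lhs t) \<le> F w0 + (\<Sum>t=1..k. rhs t)"
    if "k \<le> T" for k
    using that
  proof (induction k)
    case 0
    then show ?case by (simp add: gap_def w_def smg_iterate_def)
  next
    case (Suc k)
    obtain w1 m1 v1 where epoch:
      "smg_epoch f n \<beta> (\<eta> (Suc k)) (q (Suc k)) (w k) (m k) n = (w1, m1, v1)"
      by (metis prod_cases3)
    have succ: "w (Suc k) = w1" "m (Suc k) = v1"
      using epoch by (simp_all add: w_def m_def smg_iterate_def case_prod_unfold Let_def)
    have "gap k = (norm (grad F (w k) - m k))\<^sup>2 \<or> m k = 0 \<and> gap k = 0"
      by (auto simp: gap_def m_def)
    from epoch_lyapunov_decrease[OF \<beta> \<eta>_nonneg r _ epoch this] q[of "Suc k"] Suc.prems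
    have "F (w (Suc k)) + 2 / 3 * \<eta> (Suc k) * gap (Suc k) \<le> F (w k) + 2 / 3 * \<eta> (Suc k) * gap k
        - lhs (Suc k) + rhs (Suc k)"
      by (simp add: succ gap_def lhs_def rhs_def)
    moreover have "\<eta> (Suc k + 1) * gap (Suc k) \<le> \<eta> (Suc k) * gap (Suc k)"
      using \<eta>_mono[of "Suc k"] by (intro mult_right_mono) (auto simp: gap_def)
    ultimately show ?case using Suc by simp
  qed
  from this[of T] have "F (w T) + 2 / 3 * \<eta> (T + 1) * gap T + (\<Sum>t=1..T. lhs t)
      \<le> F w0 + (\<Sum>t=1..T. rhs t)" by simp
  moreover have "0 \<le> 2 / 3 * \<eta> (T + 1) * gap T"
    using \<eta>_nonneg[of "T + 1"] by (simp add: gap_def)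
  ultimately have "(\<Sum>t=1..T. lhs t) \<le> F w0 - Fstar + (\<Sum>t=1..T. rhs t)"
    using Fstar[of "w T"] by linarith
  then show ?thesis unfolding lhs_def rhs_def .
qed

end

section \<open>Expected shuffling deviation\<close>

lemma finite_perms [simp]: "finite (perms n)"
  by (simp add: perms_def finite_permutations)

lemma card_perms: "card (perms n) = fact n"
  using card_permutations[of "{1..n}" n] by (simp add: perms_def)

lemma smg_iterate_cong:
  assumes "\<And>s. s \<in> {1..t} \<Longrightarrow> q s = q' s"
  shows "smg_iterate f n \<beta> \<eta> q w0 t = smg_iterate f n \<beta> \<eta> q' w0 t"
proof -
  have "smg_state f n \<beta> \<eta> q w0 t = smg_state f n \<beta> \<eta> q' w0 t"
    using assms by (induction t) simp_all
  then show ?thesis by (simp add: smg_iterate_def)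
qed

context smooth_finite_sum
begin

text \<open>
  At a fixed point \<open>x\<close>, a uniformly random order has expected shuffling deviation of order
  \<open>V / n\<close>. This factor \<open>1 / n\<close> is the gain of random reshuffling over an arbitrary order.
\<close>

lemma sum_perms_shuffling_deviation_le:
  assumes V: "(1 / real n) * (\<Sum>i=1..n. (norm (grad (f i) x - grad F x))\<^sup>2) \<le> V"
  shows "(\<Sum>p\<in>perms n. shuffling_deviation f F n p x) \<le> fact n * (V / (2 * real n))"
proof -
  have npos: "real n > 0" using n by simp
  define \<xi> where "\<xi> i = grad (f i) x - grad F x" for i
  have V': "(\<Sum>i=1..n. (norm (\<xi> i))\<^sup>2) \<le> real n * V"
    using V npos by (simp add: \<xi>_def field_simps)
  have prefix: "(\<Sum>p\<in>perms n. (norm (\<Sum>j<i. \<xi> (p (j + 1))))\<^sup>2) \<le> real i * (fact n * V)"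
    if "i < n" for i
  proof -
    have shift: "(\<Sum>j<i. \<xi> (p (j + 1))) = (\<Sum>j=1..i. \<xi> (p j))" for p :: "nat \<Rightarrow> nat"
      by (rule sum.reindex_bij_witness[of _ "\<lambda>j. j - 1" "\<lambda>i. i + 1"]) auto
    have "(\<Sum>p\<in>perms n. (norm (\<Sum>j<i. \<xi> (p (j + 1))))\<^sup>2)
        = (\<Sum>p | p permutes {1..n}. (norm (\<Sum>j=1..i. \<xi> (p j)))\<^sup>2)"
      unfolding perms_def by (simp only: shift)
    also have "\<dots> \<le> real i * (fact n / real n * (\<Sum>i=1..n. (norm (\<xi> i))\<^sup>2))"
      using sum_permutes_norm_sum_squared_le[of "{1..n}" \<xi> "{1..i}"] sum_grad_deviation[of x] that
      by (simp add: \<xi>_def)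
    also have "\<dots> \<le> real i * (fact n / real n * (real n * V))"
      by (intro mult_left_mono V') auto
    finally show ?thesis using npos by simp
  qed
  have "0 \<le> (1 / real n) * (\<Sum>i=1..n. (norm (grad (f i) x - grad F x))\<^sup>2)"
    by (intro mult_nonneg_nonneg sum_nonneg) auto
  then have V0: "0 \<le> V" using V by linarith
  have "(\<Sum>p\<in>perms n. shuffling_deviation f F n p x)
      = (1 / real n ^ 3) * (\<Sum>i<n. \<Sum>p\<in>perms n. (norm (\<Sum>j<i. \<xi> (p (j + 1))))\<^sup>2)"
    unfolding shuffling_deviation_def \<xi>_def sum_distrib_left[symmetric]
    by (subst sum.swap) (rule refl)
  also have "\<dots> \<le> (1 / real n ^ 3) * (\<Sum>i<n. real i * (fact n * V))"
    by (intro mult_left_mono sum_mono prefix) auto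
  also have "\<dots> \<le> (1 / real n ^ 3) * ((real n)\<^sup>2 / 2 * (fact n * V))"
    unfolding sum_distrib_right[symmetric] using V0
    by (intro mult_left_mono mult_right_mono sum_lessThan_le) auto
  also have "\<dots> = fact n * (V / (2 * real n))"
    using npos by (simp add: field_simps power2_eq_square power3_eq_cube)
  finally show ?thesis .
qed

end

section \<open>Expectations over finite-valued random variables\<close>

lemma (in prob_space) integrable_finite_valued:
  fixes h :: "'b \<Rightarrow> real"
  assumes X: "X \<in> measurable M (count_space A)" and A: "finite A"
  shows "integrable M (\<lambda>\<omega>. h (X \<omega>))"
proof (rule integrable_const_bound[where B = "\<Sum>a\<in>A. \<bar>h a\<bar>"])
  show "AE \<omega> in M. norm (h (X \<omega>)) \<le> (\<Sum>a\<in>A. \<bar>h a\<bar>)"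
    using measurable_space[OF X] A
    by (intro AE_I2) (auto intro: member_le_sum)
  show "(\<lambda>\<omega>. h (X \<omega>)) \<in> borel_measurable M"
    using measurable_compose[OF X, of h borel] by simp
qed

text \<open>
  If \<open>X\<close> takes finitely many values and every event \<open>X = a\<close> is independent of the event \<open>B\<close>, then
  functions of \<open>X\<close> are uncorrelated with the indicator of \<open>B\<close>.
\<close>

lemma (in prob_space) expectation_indicator_times_finite_valued:
  fixes h :: "'b \<Rightarrow> real"
  assumes X: "X \<in> measurable M (count_space A)" and A: "finite A"
    and B: "B \<in> events"
    and indep: "\<And>a. a \<in> A \<Longrightarrow>
      prob ({\<omega> \<in> space M. X \<omega> = a} \<inter> B) = prob {\<omega> \<in> space M. X \<omega> = a} * prob B"
  shows "integrable M (\<lambda>\<omega>. indicator B \<omega> * h (X \<omega>))"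
    and "(\<integral>\<omega>. indicator B \<omega> * h (X \<omega>) \<partial>M) = prob B * (\<integral>\<omega>. h (X \<omega>) \<partial>M)"
proof -
  have ev: "{\<omega> \<in> space M. X \<omega> = a} \<in> events" if "a \<in> A" for a
    using measurable_sets[OF X, of "{a}"] that by (simp add: vimage_def Int_def conj_commute)
  have expand: "h (X \<omega>) = (\<Sum>a\<in>A. h a * indicator {\<omega> \<in> space M. X \<omega> = a} \<omega>)"
    if "\<omega> \<in> space M" for \<omega>
    using measurable_space[OF X that] that A by (simp add: indicator_def sum.delta if_distrib cong: if_cong)
  have expand': "indicator B \<omega> * h (X \<omega>) = (\<Sum>a\<in>A. h a * indicator ({\<omega> \<in> space M. X \<omega> = a} \<inter> B) \<omega>)"
    if "\<omega> \<in> space M" for \<omega>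
    unfolding expand[OF that] sum_distrib_left by (intro sum.cong refl) (simp add: indicator_inter_arith)
  have int: "integrable M (\<lambda>\<omega>. h a * indicator ({\<omega> \<in> space M. X \<omega> = a} \<inter> B) \<omega>)"
    "integrable M (\<lambda>\<omega>. h a * indicator {\<omega> \<in> space M. X \<omega> = a} \<omega>)" if "a \<in> A" for a
    using ev[OF that] B by (auto intro!: integrable_mult_right simp: emeasure_eq_measure)
  show "integrable M (\<lambda>\<omega>. indicator B \<omega> * h (X \<omega>))"
    by (subst Bochner_Integration.integrable_cong[OF refl expand']) (auto intro!: Bochner_Integration.integrable_sum int)
  have "(\<integral>\<omega>. indicator B \<omega> * h (X \<omega>) \<partial>M)
      = (\<integral>\<omega>. (\<Sum>a\<in>A. h a * indicator ({\<omega> \<in> space M. X \<omega> = a} \<inter> B) \<omega>) \<partial>M)"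
    by (rule Bochner_Integration.integral_cong[OF refl expand'])
  also have "\<dots> = (\<Sum>a\<in>A. h a * prob ({\<omega> \<in> space M. X \<omega> = a} \<inter> B))"
    using int ev B by (subst Bochner_Integration.integral_sum) auto
  also have "\<dots> = prob B * (\<Sum>a\<in>A. h a * prob {\<omega> \<in> space M. X \<omega> = a})"
    unfolding sum_distrib_left by (intro sum.cong refl) (simp add: indep)
  also have "(\<Sum>a\<in>A. h a * prob {\<omega> \<in> space M. X \<omega> = a})
      = (\<integral>\<omega>. (\<Sum>a\<in>A. h a * indicator {\<omega> \<in> space M. X \<omega> = a} \<omega>) \<partial>M)"
    using int ev by (subst Bochner_Integration.integral_sum) auto
  also have "\<dots> = (\<integral>\<omega>. h (X \<omega>) \<partial>M)"
    by (rule Bochner_Integration.integral_cong[OF refl expand[symmetric]])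
  finally show "(\<integral>\<omega>. indicator B \<omega> * h (X \<omega>) \<partial>M) = prob B * (\<integral>\<omega>. h (X \<omega>) \<partial>M)" .
qed

section \<open>Independence of the epochs\<close>

text \<open>
  The permutations of the epochs \<open>1..T\<close> are independent and uniformly distributed. The history of
  a set \<open>J\<close> of epochs is the function \<open>\<lambda>s\<in>J. \<pi> s \<omega>\<close>, which ranges over a finite set.
\<close>

locale random_reshuffling = prob_space M for M :: "'s measure" +
  fixes n T :: nat and \<pi> :: "nat \<Rightarrow> 's \<Rightarrow> nat \<Rightarrow> nat"
  assumes reshuffling: "randomized_reshuffling M n T \<pi>"
begin

lemma indep_perms: "indep_vars (\<lambda>_. count_space (perms n)) \<pi> {1..T}"
  using reshuffling by (simp add: randomized_reshuffling_def)

lemma measurable_perm: "t \<in> {1..T} \<Longrightarrow> \<pi> t \<in> measurable M (count_space (perms n))"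
  using indep_perms unfolding indep_vars_def by blast

lemma prob_perm:
  assumes t: "t \<in> {1..T}" and p: "p \<in> perms n"
  shows "prob {\<omega> \<in> space M. \<pi> t \<omega> = p} = 1 / fact n"
proof -
  have "prob {\<omega> \<in> space M. \<pi> t \<omega> = p} = measure (distr M (count_space (perms n)) (\<pi> t)) {p}"
    using measurable_perm[OF t] p
    by (subst measure_distr) (auto intro!: arg_cong[where f = prob])
  also have "\<dots> = measure (uniform_count_measure (perms n)) {p}"
    using reshuffling t by (simp add: randomized_reshuffling_def)
  also have "\<dots> = 1 / fact n"
    using p by (subst measure_uniform_count_measure) (auto simp: card_perms)
  finally show ?thesis .
qed

lemma measurable_history:
  assumes "J \<subseteq> {1..T}"
  shows "(\<lambda>\<omega>. \<lambda>s\<in>J. \<pi> s \<omega>) \<in> measurable M (count_space (PiE J (\<lambda>_. perms n)))"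
proof -
  have "finite J" using assms finite_subset by blast
  then have "PiM J (\<lambda>_. count_space (perms n)) = count_space (PiE J (\<lambda>_. perms n))"
    by (intro count_space_PiM_finite) (auto intro: countable_finite)
  moreover have "(\<lambda>\<omega>. \<lambda>s\<in>J. \<pi> s \<omega>) \<in> measurable M (PiM J (\<lambda>_. count_space (perms n)))"
    using assms by (intro measurable_restrict measurable_perm) auto
  ultimately show ?thesis by simp
qed

lemma finite_histories: "J \<subseteq> {1..T} \<Longrightarrow> finite (PiE J (\<lambda>_. perms n))"
  by (intro finite_PiE) (auto intro: finite_subset)

lemma prob_history_inter_perm:
  assumes t: "t \<in> {1..T}" and p: "p \<in> perms n" and a: "a \<in> PiE {1..<t} (\<lambda>_. perms n)"
  shows "prob ({\<omega> \<in> space M. (\<lambda>s\<in>{1..<t}. \<pi> s \<omega>) = a} \<inter> {\<omega> \<in> space M. \<pi> t \<omega> = p})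
    = prob {\<omega> \<in> space M. (\<lambda>s\<in>{1..<t}. \<pi> s \<omega>) = a} * prob {\<omega> \<in> space M. \<pi> t \<omega> = p}"
proof -
  let ?S = "\<lambda>J. PiM J (\<lambda>_. count_space (perms n))"
  define b where "b = (\<lambda>s\<in>{t}. p)"
  have sets: "sets (?S J) = Pow (PiE J (\<lambda>_. perms n))" if "finite J" for J :: "nat set"
    using that by (subst count_space_PiM_finite) (auto intro: countable_finite)
  have "indep_var (?S {1..<t}) (\<lambda>\<omega>. \<lambda>s\<in>{1..<t}. \<pi> s \<omega>) (?S {t}) (\<lambda>\<omega>. \<lambda>s\<in>{t}. \<pi> s \<omega>)"
    using t by (intro indep_var_restrict[OF indep_perms]) auto
  moreover have "{a} \<in> sets (?S {1..<t})" "{b} \<in> sets (?S {t})"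
    using a p by (auto simp: sets b_def)
  ultimately have "prob ((\<lambda>\<omega>. (\<lambda>s\<in>{1..<t}. \<pi> s \<omega>, \<lambda>s\<in>{t}. \<pi> s \<omega>)) -` ({a} \<times> {b}) \<inter> space M)
      = prob ((\<lambda>\<omega>. \<lambda>s\<in>{1..<t}. \<pi> s \<omega>) -` {a} \<inter> space M) * prob ((\<lambda>\<omega>. \<lambda>s\<in>{t}. \<pi> s \<omega>) -` {b} \<inter> space M)"
    by (rule indep_varD)
  moreover have "(\<lambda>s\<in>{t}. \<pi> s \<omega>) = b \<longleftrightarrow> \<pi> t \<omega> = p" for \<omega>
    unfolding b_def by (auto simp: fun_eq_iff restrict_def)
  ultimately show ?thesis
    by (simp add: vimage_def Int_def conj_ac)
qed

text \<open>
  The permutation of epoch \<open>t\<close> can be averaged out while the history of the previous epochs is kept: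
  this plays the part of the conditional expectation given the past.
\<close>

lemma expectation_fresh_perm:
  fixes h :: "(nat \<Rightarrow> nat) \<Rightarrow> (nat \<Rightarrow> nat \<Rightarrow> nat) \<Rightarrow> real"
  assumes t: "t \<in> {1..T}"
  shows "integrable M (\<lambda>\<omega>. h (\<pi> t \<omega>) (\<lambda>s\<in>{1..<t}. \<pi> s \<omega>))"
    and "(\<integral>\<omega>. h (\<pi> t \<omega>) (\<lambda>s\<in>{1..<t}. \<pi> s \<omega>) \<partial>M)
      = (\<integral>\<omega>. (\<Sum>p\<in>perms n. h p (\<lambda>s\<in>{1..<t}. \<pi> s \<omega>)) \<partial>M) / fact n"
proof -
  define X where "X \<omega> = (\<lambda>s\<in>{1..<t}. \<pi> s \<omega>)" for \<omega>
  define B where "B p = {\<omega> \<in> space M. \<pi> t \<omega> = p}" for p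
  have J: "{1..<t} \<subseteq> {1..T}" using t by auto
  have X: "X \<in> measurable M (count_space (PiE {1..<t} (\<lambda>_. perms n)))"
    unfolding X_def by (rule measurable_history[OF J])
  have B: "B p \<in> events" if "p \<in> perms n" for p
    using measurable_sets[OF measurable_perm[OF t], of "{p}"] that
    by (simp add: B_def vimage_def Int_def conj_commute)
  have split: "h (\<pi> t \<omega>) (X \<omega>) = (\<Sum>p\<in>perms n. indicator (B p) \<omega> * h p (X \<omega>))"
    if "\<omega> \<in> space M" for \<omega>
    using measurable_space[OF measurable_perm[OF t] that] that
    by (simp add: B_def indicator_def if_distrib[of "\<lambda>c. c * _"] sum.delta cong: if_cong)
  note finite_valued = expectation_indicator_times_finite_valued[OF X finite_histories[OF J] B]
  have int: "integrable M (\<lambda>\<omega>. indicator (B p) \<omega> * h p (X \<omega>))"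
    and E: "(\<integral>\<omega>. indicator (B p) \<omega> * h p (X \<omega>) \<partial>M) = prob (B p) * (\<integral>\<omega>. h p (X \<omega>) \<partial>M)"
    if p: "p \<in> perms n" for p
    using finite_valued[OF p, of "h p"] prob_history_inter_perm[OF t p] unfolding B_def X_def by blast+
  show "integrable M (\<lambda>\<omega>. h (\<pi> t \<omega>) (\<lambda>s\<in>{1..<t}. \<pi> s \<omega>))"
    unfolding X_def[symmetric]
    by (rule iffD2[OF Bochner_Integration.integrable_cong[OF refl split]],
      assumption, intro Bochner_Integration.integrable_sum int)
  have "(\<integral>\<omega>. h (\<pi> t \<omega>) (X \<omega>) \<partial>M) = (\<integral>\<omega>. (\<Sum>p\<in>perms n. indicator (B p) \<omega> * h p (X \<omega>)) \<partial>M)"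
    by (rule Bochner_Integration.integral_cong[OF refl split])
  also have "\<dots> = (\<Sum>p\<in>perms n. prob (B p) * (\<integral>\<omega>. h p (X \<omega>) \<partial>M))"
    by (subst Bochner_Integration.integral_sum) (auto simp: int E)
  also have "\<dots> = (\<Sum>p\<in>perms n. (\<integral>\<omega>. h p (X \<omega>) \<partial>M)) / fact n"
    using prob_perm[OF t] by (simp add: B_def sum_divide_distrib)
  also have "(\<Sum>p\<in>perms n. (\<integral>\<omega>. h p (X \<omega>) \<partial>M)) = (\<integral>\<omega>. (\<Sum>p\<in>perms n. h p (X \<omega>)) \<partial>M)"
    by (rule Bochner_Integration.integral_sum[symmetric])
      (rule integrable_finite_valued[OF X finite_histories[OF J]])
  finally show "(\<integral>\<omega>. h (\<pi> t \<omega>) (\<lambda>s\<in>{1..<t}. \<pi> s \<omega>) \<partial>M)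
      = (\<integral>\<omega>. (\<Sum>p\<in>perms n. h p (\<lambda>s\<in>{1..<t}. \<pi> s \<omega>)) \<partial>M) / fact n"
    unfolding X_def .
qed

text \<open>
  The output index is independent of all permutations, so it can be averaged out first.
\<close>

lemma expectation_random_output:
  fixes h :: "nat \<Rightarrow> (nat \<Rightarrow> nat \<Rightarrow> nat) \<Rightarrow> real"
  assumes K: "random_output_index M n T \<eta> \<pi> K"
  shows "(\<integral>\<omega>. h (K \<omega>) (\<lambda>s\<in>{1..T}. \<pi> s \<omega>) \<partial>M)
    = (1 / (\<Sum>t=1..T. \<eta> t)) * (\<Sum>t=1..T. \<eta> t * (\<integral>\<omega>. h t (\<lambda>s\<in>{1..T}. \<pi> s \<omega>) \<partial>M))"
proof -
  define X where "X \<omega> = (\<lambda>s\<in>{1..T}. \<pi> s \<omega>)" for \<omega>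
  define B where "B t = {\<omega> \<in> space M. K \<omega> = t}" for t
  have X: "X \<in> measurable M (count_space (PiE {1..T} (\<lambda>_. perms n)))"
    unfolding X_def by (rule measurable_history) simp
  have K_meas: "K \<in> measurable M (count_space {1..T})"
    and K_prob: "\<And>t. t \<in> {1..T} \<Longrightarrow> prob (B t) = \<eta> t / (\<Sum>s=1..T. \<eta> s)"
    and K_indep: "indep_set
      {X -` A \<inter> space M | A. A \<in> sets (Pi\<^sub>M {1..T} (\<lambda>_. count_space (perms n)))}
      {K -` C \<inter> space M | C. C \<in> sets (count_space {1..T})}"
    using K unfolding random_output_index_def B_def X_def by blast+
  have B: "B t \<in> events" if "t \<in> {1..T}" for t
    using measurable_sets[OF K_meas, of "{t}"] that
    by (simp add: B_def vimage_def Int_def conj_commute)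
  have indep: "prob ({\<omega> \<in> space M. X \<omega> = a} \<inter> B t) = prob {\<omega> \<in> space M. X \<omega> = a} * prob (B t)"
    if t: "t \<in> {1..T}" and a: "a \<in> PiE {1..T} (\<lambda>_. perms n)" for t a
  proof (rule indep_setD[OF K_indep])
    have "{a} \<in> sets (Pi\<^sub>M {1..T} (\<lambda>_. count_space (perms n)))"
      using a by (subst count_space_PiM_finite) (auto intro: countable_finite)
    then show "{\<omega> \<in> space M. X \<omega> = a}
        \<in> {X -` A \<inter> space M | A. A \<in> sets (Pi\<^sub>M {1..T} (\<lambda>_. count_space (perms n)))}"
      by (auto intro!: exI[of _ "{a}"])
    show "B t \<in> {K -` C \<inter> space M | C. C \<in> sets (count_space {1..T})}"
      using t by (auto simp: B_def intro!: exI[of _ "{t}"])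
  qed
  have split: "h (K \<omega>) (X \<omega>) = (\<Sum>t=1..T. indicator (B t) \<omega> * h t (X \<omega>))"
    if "\<omega> \<in> space M" for \<omega>
    using measurable_space[OF K_meas that] that
    by (simp add: B_def indicator_def if_distrib[of "\<lambda>c. c * _"] sum.delta cong: if_cong)
  note finite_valued = expectation_indicator_times_finite_valued[OF X finite_histories[OF order_refl] B indep]
  have "(\<integral>\<omega>. h (K \<omega>) (X \<omega>) \<partial>M) = (\<integral>\<omega>. (\<Sum>t=1..T. indicator (B t) \<omega> * h t (X \<omega>)) \<partial>M)"
    by (rule Bochner_Integration.integral_cong[OF refl split])
  also have "\<dots> = (\<Sum>t=1..T. prob (B t) * (\<integral>\<omega>. h t (X \<omega>) \<partial>M))"
    by (subst Bochner_Integration.integral_sum) (auto intro!: sum.cong finite_valued)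
  also have "\<dots> = (1 / (\<Sum>t=1..T. \<eta> t)) * (\<Sum>t=1..T. \<eta> t * (\<integral>\<omega>. h t (X \<omega>) \<partial>M))"
    unfolding sum_distrib_left by (intro sum.cong refl) (simp add: K_prob)
  finally show ?thesis unfolding X_def .
qed

end

section \<open>Convergence rate\<close>

theorem theorem2:
  fixes f :: "nat \<Rightarrow> real ^ 'd \<Rightarrow> real"
    and F :: "real ^ 'd \<Rightarrow> real"
    and n T :: nat
    and L \<Theta> \<sigma> \<beta> D Fstar :: real
    and \<eta> :: "nat \<Rightarrow> real"
    and w0 :: "real ^ 'd"
    and M :: "'s measure"
    and \<pi> :: "nat \<Rightarrow> 's \<Rightarrow> nat \<Rightarrow> nat"
    and K :: "'s \<Rightarrow> nat"
    and w :: "nat \<Rightarrow> 's \<Rightarrow> real ^ 'd"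
    and w_hat :: "'s \<Rightarrow> real ^ 'd"
  assumes n: "n \<ge> 1" and T: "T \<ge> 1"
    and F: "F = (\<lambda>x. (1 / real n) * (\<Sum>i=1..n. f i x))"
    and f_diff: "\<And>i x. i \<in> {1..n} \<Longrightarrow> f i differentiable (at x)"
    and F_bdd: "bdd_below (range F)"
    and Fstar: "Fstar = (INF x. F x)"
    and L_pos: "L > 0"
    and f_smooth: "\<And>i x y. i \<in> {1..n} \<Longrightarrow>
      norm (grad (f i) x - grad (f i) y) \<le> L * norm (x - y)"
    and \<Theta>: "\<Theta> \<ge> 0" and \<sigma>: "\<sigma> \<ge> 0"
    and f_var: "\<And>x. (1 / real n) * (\<Sum>i=1..n. (norm (grad (f i) x - grad F x))\<^sup>2)
      \<le> \<Theta> * (norm (grad F x))\<^sup>2 + \<sigma>\<^sup>2"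
    and \<beta>: "0 \<le> \<beta>" "\<beta> < 1"
    and D: "D = max (5 / 3) (6 * (5 - 3 * \<beta>) * (\<Theta> + real n) / (real n * (1 - \<beta>)))"
    and \<eta>_0: "\<eta> 0 = \<eta> 1"
    and \<eta>_mono: "\<And>t. t \<ge> 1 \<Longrightarrow> \<eta> t \<ge> \<eta> (t + 1)"
    and \<eta>_bounds: "\<And>t. t \<ge> 1 \<Longrightarrow> 0 < \<eta> t \<and> \<eta> t \<le> 1 / (L * sqrt D)"
    and M: "prob_space M"
    and \<pi>: "randomized_reshuffling M n T \<pi>"
    and K: "random_output_index M n T \<eta> \<pi> K"
    and w: "\<And>t \<omega>. w t \<omega> = smg_iterate f n \<beta> \<eta> (\<lambda>s. \<pi> s \<omega>) w0 t"
    and w_hat: "\<And>\<omega>. w_hat \<omega> = w (K \<omega> - 1) \<omega>"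
  shows "(\<integral>\<omega>. (norm (grad F (w_hat \<omega>)))\<^sup>2 \<partial>M) =
      (1 / (\<Sum>t=1..T. \<eta> t)) * (\<Sum>t=1..T. \<eta> t * (\<integral>\<omega>. (norm (grad F (w (t - 1) \<omega>)))\<^sup>2 \<partial>M))
    \<and> (1 / (\<Sum>t=1..T. \<eta> t)) * (\<Sum>t=1..T. \<eta> t * (\<integral>\<omega>. (norm (grad F (w (t - 1) \<omega>)))\<^sup>2 \<partial>M)) \<le>
      4 * (F w0 - Fstar) / ((1 - \<beta>) * (\<Sum>t=1..T. \<eta> t))
      + 6 * \<sigma>\<^sup>2 * (5 - 3 * \<beta>) * L\<^sup>2 / (real n * (1 - \<beta>))
        * ((\<Sum>t=1..T. \<eta> (t - 1) ^ 3) / (\<Sum>t=1..T. \<eta> t))"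
proof -
  interpret smooth_finite_sum f F n L
    by unfold_locales (fact n F f_diff f_smooth)+
  interpret prob_space M by (fact M)
  interpret random_reshuffling M n T \<pi>
    by unfold_locales (fact \<pi>)
  define G where "G t \<omega> = (norm (grad F (w (t - 1) \<omega>)))\<^sup>2" for t \<omega>
  define W where "W t \<omega> = shuffling_deviation f F n (\<pi> t \<omega>) (w (t - 1) \<omega>)" for t \<omega>
  define S where "S = (\<Sum>t=1..T. \<eta> t)"
  define b where "b = 1 - \<beta>"
  have b: "0 < b" "b \<le> 1" using \<beta> by (auto simp: b_def)
  have npos: "real n > 0" using n by simp
  have S_pos: "S > 0"
    unfolding S_def using T \<eta>_bounds by (intro sum_pos) auto
  define iter where "iter = (\<lambda>q t. smg_iterate f n \<beta> \<eta> q w0 t)"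
  have w_history: "w t \<omega> = iter (\<lambda>s\<in>J. \<pi> s \<omega>) t"
    if "{1..t} \<subseteq> J" for t J \<omega>
    unfolding w iter_def using that by (intro smg_iterate_cong) auto

  have "(\<integral>\<omega>. G (K \<omega>) \<omega> \<partial>M) = (1 / S) * (\<Sum>t=1..T. \<eta> t * (\<integral>\<omega>. G t \<omega> \<partial>M))"
  proof -
    define h where "h t q = (norm (grad F (iter q (t - 1))))\<^sup>2" for t q
    have h: "G t \<omega> = h t (\<lambda>s\<in>{1..T}. \<pi> s \<omega>)" if "t \<in> {1..T}" for t \<omega>
      unfolding G_def h_def using that by (subst w_history[of _ "{1..T}"]) auto
    have "K \<in> measurable M (count_space {1..T})"
      using K unfolding random_output_index_def by (rule conjunct1)
    from measurable_space[OF this] have K_range: "K \<omega> \<in> {1..T}" if "\<omega> \<in> space M" for \<omega>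
      using that by simp
    have "(\<integral>\<omega>. G (K \<omega>) \<omega> \<partial>M) = (\<integral>\<omega>. h (K \<omega>) (\<lambda>s\<in>{1..T}. \<pi> s \<omega>) \<partial>M)"
      by (intro Bochner_Integration.integral_cong refl h K_range)
    also have "\<dots> = (1 / S) * (\<Sum>t=1..T. \<eta> t * (\<integral>\<omega>. h t (\<lambda>s\<in>{1..T}. \<pi> s \<omega>) \<partial>M))"
      unfolding S_def by (rule expectation_random_output[OF K])
    finally show ?thesis by (simp add: h)
  qed
  then have output_mean: "(\<integral>\<omega>. (norm (grad F (w_hat \<omega>)))\<^sup>2 \<partial>M)
      = (1 / S) * (\<Sum>t=1..T. \<eta> t * (\<integral>\<omega>. G t \<omega> \<partial>M))"
    by (simp add: G_def w_hat)

  have G_int: "integrable M (G t)" if t: "t \<in> {1..T}" for t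
    using expectation_fresh_perm(1)[OF t, of "\<lambda>p q. (norm (grad F (iter q (t - 1))))\<^sup>2"] t
    unfolding G_def by (subst w_history[of _ "{1..<t}"]) auto
  have W_history: "W t \<omega> = shuffling_deviation f F n (\<pi> t \<omega>) (iter (\<lambda>s\<in>{1..<t}. \<pi> s \<omega>) (t - 1))"
    if "t \<in> {1..T}" for t \<omega>
    unfolding W_def using that by (subst w_history[of _ "{1..<t}"]) auto
  have W_int: "integrable M (W t)" if t: "t \<in> {1..T}" for t
    unfolding W_history[OF t, abs_def] by (rule expectation_fresh_perm(1)[OF t])
  have W_le: "(\<integral>\<omega>. W t \<omega> \<partial>M) \<le> (\<Theta> * (\<integral>\<omega>. G t \<omega> \<partial>M) + \<sigma>\<^sup>2) / (2 * real n)"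
    if t: "t \<in> {1..T}" for t
  proof -
    have hist: "w (t - 1) \<omega> = iter (\<lambda>s\<in>{1..<t}. \<pi> s \<omega>) (t - 1)" for \<omega>
      using t by (intro w_history) auto
    have "(\<integral>\<omega>. W t \<omega> \<partial>M) = (\<integral>\<omega>. (\<Sum>p\<in>perms n. shuffling_deviation f F n p (w (t - 1) \<omega>)) \<partial>M) / fact n"
      unfolding W_history[OF t] hist
      by (rule expectation_fresh_perm(2)[OF t, of "\<lambda>p q. shuffling_deviation f F n p (iter q (t - 1))"])
    also have "\<dots> \<le> (\<integral>\<omega>. fact n * ((\<Theta> * G t \<omega> + \<sigma>\<^sup>2) / (2 * real n)) \<partial>M) / fact n"
    proof (intro divide_right_mono integral_mono)
      show "integrable M (\<lambda>\<omega>. \<Sum>p\<in>perms n. shuffling_deviation f F n p (w (t - 1) \<omega>))"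
        unfolding hist
        by (rule expectation_fresh_perm(1)[OF t, of "\<lambda>_ q. \<Sum>p\<in>perms n. shuffling_deviation f F n p (iter q (t - 1))"])
      show "(\<Sum>p\<in>perms n. shuffling_deviation f F n p (w (t - 1) \<omega>))
          \<le> fact n * ((\<Theta> * G t \<omega> + \<sigma>\<^sup>2) / (2 * real n))" for \<omega>
        unfolding G_def by (rule sum_perms_shuffling_deviation_le[OF f_var])
    qed (use G_int[OF t] in auto)
    also have "\<dots> = (\<Theta> * (\<integral>\<omega>. G t \<omega> \<partial>M) + \<sigma>\<^sup>2) / (2 * real n)"
      using G_int[OF t] by (simp add: prob_space)
    finally show ?thesis .
  qed

  \<comment> \<open>The upper bound on the learning rate is used only in the form of \<open>r\<close> and its consequence \<open>r_small\<close>.\<close>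
  have D_ge: "6 * (5 - 3 * \<beta>) * (1 + \<Theta> / real n) \<le> D * b"
  proof -
    have "6 * (5 - 3 * \<beta>) * (\<Theta> + real n) / (real n * b) \<le> D" unfolding D b_def by simp
    then show ?thesis using npos b by (simp add: field_simps)
  qed
  have r_D: "L\<^sup>2 * (\<eta> t)\<^sup>2 * D \<le> 1" if "t \<ge> 1" for t
  proof -
    have D_pos: "D > 0" unfolding D by simp
    have "\<eta> t * (L * sqrt D) \<le> 1"
      using \<eta>_bounds[OF that] L_pos D_pos by (simp add: field_simps)
    then have "(\<eta> t * (L * sqrt D))\<^sup>2 \<le> 1"
      using \<eta>_bounds[OF that] L_pos D_pos by (intro power_le_one) auto
    then show ?thesis using D_pos by (simp add: power_mult_distrib mult_ac)
  qed
  have r: "L\<^sup>2 * (\<eta> t)\<^sup>2 * (6 * (5 - 3 * \<beta>) * (1 + \<Theta> / real n)) \<le> b" if "t \<ge> 1" for t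
  proof -
    have "L\<^sup>2 * (\<eta> t)\<^sup>2 * (6 * (5 - 3 * \<beta>) * (1 + \<Theta> / real n)) \<le> L\<^sup>2 * (\<eta> t)\<^sup>2 * (D * b)"
      by (intro mult_left_mono D_ge) auto
    also have "\<dots> = L\<^sup>2 * (\<eta> t)\<^sup>2 * D * b" by simp
    also have "\<dots> \<le> 1 * b" using r_D[OF that] b by (intro mult_right_mono) auto
    finally show ?thesis by simp
  qed
  have r_small: "L\<^sup>2 * (\<eta> t)\<^sup>2 \<le> 1 / 30" if "t \<ge> 1" for t
  proof -
    have "30 * b \<le> 6 * (5 - 3 * \<beta>) * 1" using \<beta> by (simp add: b_def)
    also have "\<dots> \<le> 6 * (5 - 3 * \<beta>) * (1 + \<Theta> / real n)"
      using \<beta> \<Theta> npos by (intro mult_left_mono) auto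
    finally have "L\<^sup>2 * (\<eta> t)\<^sup>2 * (30 * b) \<le> L\<^sup>2 * (\<eta> t)\<^sup>2 * (6 * (5 - 3 * \<beta>) * (1 + \<Theta> / real n))"
      by (intro mult_left_mono) auto
    with r[OF that] have "(L\<^sup>2 * (\<eta> t)\<^sup>2 * 30) * b \<le> 1 * b" by simp
    then show ?thesis using b by simp
  qed

  \<comment> \<open>Taking expectations in the pathwise bound; \<open>c1\<close> and \<open>c2\<close> are its constants.\<close>
  define g where "g t = (\<integral>\<omega>. G t \<omega> \<partial>M)" for t
  define c1 where "c1 = b * (9 / 16) + 9 / 4"
  define c2 where "c2 = b * (9 / 4) + 10 / 3"
  have g_nonneg: "g t \<ge> 0" for t unfolding g_def G_def by simp
  have "(\<integral>\<omega>. (\<Sum>t=1..T. \<eta> t * (b / 2) * G t \<omega>) \<partial>M)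
      \<le> (\<integral>\<omega>. (F w0 - Fstar) + (\<Sum>t=1..T. \<eta> t * (L\<^sup>2 * (\<eta> t)\<^sup>2) * (c1 * G t \<omega> + c2 * W t \<omega>)) \<partial>M)"
  proof (rule integral_mono)
    fix \<omega> assume \<omega>: "\<omega> \<in> space M"
    show "(\<Sum>t=1..T. \<eta> t * (b / 2) * G t \<omega>)
      \<le> (F w0 - Fstar) + (\<Sum>t=1..T. \<eta> t * (L\<^sup>2 * (\<eta> t)\<^sup>2) * (c1 * G t \<omega> + c2 * W t \<omega>))"
      unfolding b_def c1_def c2_def G_def W_def w
    proof (rule smg_trajectory_bound)
      show "\<pi> t \<omega> permutes {1..n}" if "t \<in> {1..T}" for t
        using measurable_space[OF measurable_perm[OF that] \<omega>] by (simp add: perms_def)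
      show "Fstar \<le> F x" for x unfolding Fstar by (rule cINF_lower[OF F_bdd]) simp
    qed (use \<beta> \<eta>_bounds \<eta>_mono r_small in \<open>auto intro: less_imp_le\<close>)
  qed (use G_int W_int in \<open>auto intro!: Bochner_Integration.integrable_sum\<close>)
  moreover have "integrable M (\<lambda>\<omega>. \<Sum>t=1..T. \<eta> t * (L\<^sup>2 * (\<eta> t)\<^sup>2) * (c1 * G t \<omega> + c2 * W t \<omega>))"
    using G_int W_int by (auto intro!: Bochner_Integration.integrable_sum)
  ultimately have "(\<Sum>t=1..T. \<eta> t * (b / 2) * g t)
      \<le> (F w0 - Fstar) + (\<Sum>t=1..T. \<eta> t * (L\<^sup>2 * (\<eta> t)\<^sup>2) * (c1 * g t + c2 * (\<integral>\<omega>. W t \<omega> \<partial>M)))"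
    using G_int W_int unfolding g_def
    by (simp add: Bochner_Integration.integral_sum Bochner_Integration.integral_add prob_space)
  also have "\<dots> \<le> (F w0 - Fstar) + (\<Sum>t=1..T. \<eta> t * (b / 4) * g t
      + 3 / 2 * (5 - 3 * \<beta>) * L\<^sup>2 * \<sigma>\<^sup>2 / real n * \<eta> (t - 1) ^ 3)"
  proof (intro add_left_mono sum_mono)
    \<comment> \<open>The gradient part of the error is at most half of the available decrease, and the rest is the
      noise term.\<close>
    fix t assume t: "t \<in> {1..T}"
    then have t1: "t \<ge> 1" by simp
    have \<eta>_pos: "\<eta> t > 0" using \<eta>_bounds[OF t1] by simp
    define \<rho> where "\<rho> = L\<^sup>2 * (\<eta> t)\<^sup>2"
    have \<rho>0: "\<rho> \<ge> 0" by (simp add: \<rho>_def)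
    have \<eta>_prev: "\<eta> t \<le> \<eta> (t - 1)"
    proof (cases "t = 1")
      case False
      then show ?thesis using \<eta>_mono[of "t - 1"] t1 by simp
    qed (simp add: \<eta>_0)
    have "c2 * (\<integral>\<omega>. W t \<omega> \<partial>M) \<le> c2 * ((\<Theta> * g t + \<sigma>\<^sup>2) / (2 * real n))"
      using W_le[OF t] b unfolding g_def c2_def by (intro mult_left_mono) auto
    also have "\<dots> = (b * (9 / 8) + 5 / 3) * (\<Theta> / real n * g t) + (b * (9 / 8) + 5 / 3) * (\<sigma>\<^sup>2 / real n)"
      using npos by (simp add: c2_def field_simps)
    also have "\<dots> \<le> (b * (9 / 8) + 9 / 4) * (\<Theta> / real n * g t) + 3 / 2 * (5 - 3 * \<beta>) * (\<sigma>\<^sup>2 / real n)"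
      using b \<beta> npos \<Theta> g_nonneg[of t]
      by (intro add_mono mult_right_mono) (auto simp: b_def field_simps)
    finally have "c1 * g t + c2 * (\<integral>\<omega>. W t \<omega> \<partial>M) \<le> (b * (9 / 8) + 9 / 4) * g t
        + (b * (9 / 8) + 9 / 4) * (\<Theta> / real n * g t) + 3 / 2 * (5 - 3 * \<beta>) * (\<sigma>\<^sup>2 / real n)"
      using mult_right_mono[of c1 "b * (9 / 8) + 9 / 4" "g t"] b g_nonneg[of t] by (simp add: c1_def)
    also have "\<dots> = (b * (9 / 8) + 9 / 4) * (1 + \<Theta> / real n) * g t + 3 / 2 * (5 - 3 * \<beta>) * (\<sigma>\<^sup>2 / real n)"
      using npos by (simp add: field_simps)
    also have "\<dots> \<le> 6 * (5 - 3 * \<beta>) / 4 * (1 + \<Theta> / real n) * g t + 3 / 2 * (5 - 3 * \<beta>) * (\<sigma>\<^sup>2 / real n)"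
      using b \<beta> npos \<Theta> g_nonneg[of t]
      by (intro add_mono mult_right_mono) (auto simp: b_def field_simps)
    finally have "\<rho> * (c1 * g t + c2 * (\<integral>\<omega>. W t \<omega> \<partial>M))
        \<le> \<rho> * (6 * (5 - 3 * \<beta>) / 4 * (1 + \<Theta> / real n) * g t + 3 / 2 * (5 - 3 * \<beta>) * (\<sigma>\<^sup>2 / real n))"
      using \<rho>0 by (intro mult_left_mono)
    also have "\<dots> = (\<rho> * (6 * (5 - 3 * \<beta>) * (1 + \<Theta> / real n))) / 4 * g t + \<rho> * (3 / 2 * (5 - 3 * \<beta>) * (\<sigma>\<^sup>2 / real n))"
      by (simp add: algebra_simps)
    also have "\<dots> \<le> b / 4 * g t + \<rho> * (3 / 2 * (5 - 3 * \<beta>) * (\<sigma>\<^sup>2 / real n))"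
      using r[OF t1] g_nonneg[of t] unfolding \<rho>_def
      by (intro add_right_mono mult_right_mono divide_right_mono) auto
    finally have "\<eta> t * (\<rho> * (c1 * g t + c2 * (\<integral>\<omega>. W t \<omega> \<partial>M)))
        \<le> \<eta> t * (b / 4 * g t + \<rho> * (3 / 2 * (5 - 3 * \<beta>) * (\<sigma>\<^sup>2 / real n)))"
      using \<eta>_pos by (intro mult_left_mono) auto
    also have "\<dots> = \<eta> t * (b / 4) * g t + 3 / 2 * (5 - 3 * \<beta>) * L\<^sup>2 * \<sigma>\<^sup>2 / real n * \<eta> t ^ 3"
      using npos by (simp add: \<rho>_def field_simps power2_eq_square power3_eq_cube)
    also have "\<dots> \<le> \<eta> t * (b / 4) * g t + 3 / 2 * (5 - 3 * \<beta>) * L\<^sup>2 * \<sigma>\<^sup>2 / real n * \<eta> (t - 1) ^ 3"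
      using \<eta>_prev \<eta>_pos \<beta> by (intro add_left_mono mult_left_mono power_mono) auto
    finally show "\<eta> t * (L\<^sup>2 * (\<eta> t)\<^sup>2) * (c1 * g t + c2 * (\<integral>\<omega>. W t \<omega> \<partial>M))
        \<le> \<eta> t * (b / 4) * g t + 3 / 2 * (5 - 3 * \<beta>) * L\<^sup>2 * \<sigma>\<^sup>2 / real n * \<eta> (t - 1) ^ 3"
      by (simp add: \<rho>_def mult.assoc)
  qed
  finally have sum_bound: "b / 4 * (\<Sum>t=1..T. \<eta> t * g t) \<le> (F w0 - Fstar)
      + 3 / 2 * (5 - 3 * \<beta>) * L\<^sup>2 * \<sigma>\<^sup>2 / real n * (\<Sum>t=1..T. \<eta> (t - 1) ^ 3)"
  proof -
    assume *: "(\<Sum>t=1..T. \<eta> t * (b / 2) * g t) \<le> (F w0 - Fstar) + (\<Sum>t=1..T. \<eta> t * (b / 4) * g t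
      + 3 / 2 * (5 - 3 * \<beta>) * L\<^sup>2 * \<sigma>\<^sup>2 / real n * \<eta> (t - 1) ^ 3)"
    have scale: "(\<Sum>t=1..T. \<eta> t * c * g t) = c * (\<Sum>t=1..T. \<eta> t * g t)" for c
      by (simp add: sum_distrib_left mult_ac)
    show ?thesis
      using * unfolding sum.distrib scale sum_distrib_left[symmetric] by linarith
  qed
  have "(1 / S) * (\<Sum>t=1..T. \<eta> t * g t) = 4 / (b * S) * (b / 4 * (\<Sum>t=1..T. \<eta> t * g t))"
    using b by simp
  also have "\<dots> \<le> 4 / (b * S) * ((F w0 - Fstar)
      + 3 / 2 * (5 - 3 * \<beta>) * L\<^sup>2 * \<sigma>\<^sup>2 / real n * (\<Sum>t=1..T. \<eta> (t - 1) ^ 3))"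
    using b S_pos by (intro mult_left_mono sum_bound) auto
  also have "\<dots> = 4 * (F w0 - Fstar) / (b * S) + 6 * \<sigma>\<^sup>2 * (5 - 3 * \<beta>) * L\<^sup>2 / (real n * b)
        * ((\<Sum>t=1..T. \<eta> (t - 1) ^ 3) / S)"
    using b S_pos npos by (simp add: field_simps)
  finally have "(1 / S) * (\<Sum>t=1..T. \<eta> t * g t)
      \<le> 4 * (F w0 - Fstar) / (b * S) + 6 * \<sigma>\<^sup>2 * (5 - 3 * \<beta>) * L\<^sup>2 / (real n * b)
        * ((\<Sum>t=1..T. \<eta> (t - 1) ^ 3) / S)" .
  with output_mean show ?thesis
    unfolding g_def G_def S_def b_def by blast
qed

end
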